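(* Let $n,m\in\mathbb{N}$, let $p(\cdot)\in\mathcal{P}(\mathbb{R}^n)$ and let $W\in\mathcal{A}_{p(\cdot)}$ be a matrix weight $W:\mathbb{R}^n\to M_m(\mathbb{R})$. Suppose that $\mathcal{F}$ is a subset of $L^{p(\cdot)}(W)$. Then $\mathcal{F}$ is precompact in $L^{p(\cdot)}(W)$ if the following three conditions hold: (i) $\mathcal{F}$ is bounded, i.e. $\sup_{\vec f\in\mathcal{F}}\|\vec f\|_{L^{p(\cdot)}(W)}<\infty$; (ii) $\mathcal{F}$ uniformly vanishes at infinity, that is, $\lim_{R\to\infty}\sup_{\vec f\in\mathcal{F}}\|\vec f\chi_{B^c(0,R)}\|_{L^{p(\cdot)}(W)}=0$; (iii) $\mathcal{F}$ is equicontinuous, that is, $\lim_{r\to0^+}\sup_{\vec f\in\mathcal{F}}\sup_{y\in B(0,r)}\|\tau_y\vec f-\vec f\|_{L^{p(\cdot)}(W)}=0$.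
   Context: For measurable $p(\cdot):\mathbb{R}^n\to(0,\infty)$ put $p^-=\operatorname{ess\,inf}p$, $p^+=\operatorname{ess\,sup}p$; $\mathcal{P}(\mathbb{R}^n)$ is the set of those $p(\cdot)$ with $p^->1$ and $p^+<\infty$, and $p'(\cdot)$ is the conjugate exponent, $1/p(x)+1/p'(x)=1$. For a scalar measurable $f$, $\|f\|_{L^{p(\cdot)}}=\inf\{\lambda>0:\int_{\mathbb{R}^n}(|f(x)|/\lambda)^{p(x)}\,dx\le1\}$ (infinite if no such $\lambda$ exists). $M_m(\mathbb{R})$ is the set of real $m\times m$ matrices, $|A|_{\mathrm{op}}=\sup_{|\vec z|=1}|A\vec z|$ with the Euclidean norm on $\mathbb{R}^m$. A matrix weight is a function $W:\mathbb{R}^n\to M_m(\mathbb{R})$ with locally integrable entries such that $W(x)$ is nonnegative definite for every $x$ and invertible for almost every $x$. $W\in\mathcal{A}_{p(\cdot)}$ means that $$[W]_{\mathcal{A}_{p(\cdot)}}:=\sup_Q|Q|^{-1}\Big\|\,\big\|\,|W(x)W^{-1}(\cdot)|_{\mathrm{op}}\chi_Q(\cdot)\big\|_{L^{p'(\cdot)}}\chi_Q(x)\Big\|_{L^{p(\cdot)}_x}<\infty,$$ the supremum being over all cubes $Q\subset\mathbb{R}^n$. $L^{p(\cdot)}(W)$ is the space of measurable $\vec f:\mathbb{R}^n\to\mathbb{R}^m$ with $\|\vec f\|_{L^{p(\cdot)}(W)}:=\|\,|W\vec f|\,\|_{L^{p(\cdot)}}<\infty$ (functions equal a.e. are identified).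 $\tau_y\vec f(x)=\vec f(x-y)$; $B(0,r)$ is the ball of centre $0$ and radius $r$, $B^c(0,R)$ is the complement of $B(0,R)$; $\chi_S$ is the characteristic function of $S$. *)

theory Defs
  imports "HOL-Analysis.Analysis" "HOL-Probability.Essential_Supremum"
begin

definition ess_lower :: "(real^'n \<Rightarrow> real) \<Rightarrow> ereal" where
  "ess_lower p = Liminf (ae_filter lebesgue) (\<lambda>x. ereal (p x))"

definition ess_upper :: "(real^'n \<Rightarrow> real) \<Rightarrow> ereal" where
  "ess_upper p = esssup lebesgue (\<lambda>x. ereal (p x))"

definition exponents :: "(real^'n \<Rightarrow> real) set" where
  "exponents = {p. p \<in> borel_measurable lebesgue \<and> (\<forall>x. 0 < p x) \<and>
     1 < ess_lower p \<and> ess_upper p < \<infinity>}"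

text \<open>The solution of \<open>1 / p x + 1 / p' x = 1\<close>, meaningful wherever \<open>p x > 1\<close>, hence almost
  everywhere for \<open>p \<in> exponents\<close>.\<close>

definition conjugate_exponent :: "(real^'n \<Rightarrow> real) \<Rightarrow> real^'n \<Rightarrow> real" where
  "conjugate_exponent p = (\<lambda>x. p x / (p x - 1))"

text \<open>Power with a positive exponent, extended by \<open>\<infinity> powr s = \<infinity>\<close>.\<close>

definition ennreal_powr :: "ennreal \<Rightarrow> real \<Rightarrow> ennreal" where
  "ennreal_powr a s = (if a = \<infinity> then \<infinity> else ennreal (enn2real a powr s))"

text \<open>The Luxemburg norm takes functions with values in \<open>[0, \<infinity>]\<close> (the absolute value is taken by the
  caller), because in the matrix \<open>A\<^bsub>p(.)\<^esub>\<close> characteristic the inner norm, which may be infinite, is the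
  integrand of the outer one.  The infimum of the empty set is \<open>\<infinity>\<close>.\<close>

definition Lp_var_norm :: "(real^'n \<Rightarrow> real) \<Rightarrow> (real^'n \<Rightarrow> ennreal) \<Rightarrow> ennreal" where
  "Lp_var_norm p f = Inf {ennreal t | t::real. 0 < t \<and>
     (\<integral>\<^sup>+ x. ennreal_powr (f x / ennreal t) (p x) \<partial>lebesgue) \<le> 1}"

definition op_norm :: "real^'m^'m \<Rightarrow> real" where
  "op_norm A = onorm (\<lambda>v. A *v v)"

definition nonneg_definite :: "real^'m^'m \<Rightarrow> bool" where
  "nonneg_definite A \<longleftrightarrow> transpose A = A \<and> (\<forall>v. 0 \<le> v \<bullet> (A *v v))"

definition matrix_weight :: "(real^'n \<Rightarrow> real^'m^'m) \<Rightarrow> bool" where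
  "matrix_weight W \<longleftrightarrow>
     (\<forall>i j K. compact K \<longrightarrow> set_integrable lebesgue K (\<lambda>x. W x $ i $ j)) \<and>
     (\<forall>x. nonneg_definite (W x)) \<and>
     (AE x in lebesgue. invertible (W x))"

text \<open>Nondegenerate cubes with sides parallel to the coordinate axes.\<close>

definition cubes :: "(real^'n) set set" where
  "cubes = {cbox a (a + vec l) | a l. 0 < l}"

definition Ap_characteristic :: "(real^'n \<Rightarrow> real) \<Rightarrow> (real^'n \<Rightarrow> real^'m^'m) \<Rightarrow> ennreal" where
  "Ap_characteristic p W = (SUP Q\<in>cubes.
     Lp_var_norm p (\<lambda>x.
       Lp_var_norm (conjugate_exponent p)
         (\<lambda>y. ennreal (op_norm (W x ** matrix_inv (W y))) * indicator Q y)
       * indicator Q x)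
     / emeasure lebesgue Q)"

definition matrix_Ap :: "(real^'n \<Rightarrow> real) \<Rightarrow> (real^'n \<Rightarrow> real^'m^'m) set" where
  "matrix_Ap p = {W. matrix_weight W \<and> Ap_characteristic p W < \<infinity>}"

definition LpW_norm ::
    "(real^'n \<Rightarrow> real) \<Rightarrow> (real^'n \<Rightarrow> real^'m^'m) \<Rightarrow> (real^'n \<Rightarrow> real^'m) \<Rightarrow> ennreal" where
  "LpW_norm p W f = Lp_var_norm p (\<lambda>x. ennreal (norm (W x *v f x)))"

text \<open>\<open>LpW_fun\<close> consists of functions; \<open>LpW\<close> is the space itself, i.e. its quotient by equality
  almost everywhere.\<close>

definition LpW_fun ::
    "(real^'n \<Rightarrow> real) \<Rightarrow> (real^'n \<Rightarrow> real^'m^'m) \<Rightarrow> (real^'n \<Rightarrow> real^'m) set" where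
  "LpW_fun p W = {f. f \<in> borel_measurable lebesgue \<and> LpW_norm p W f < \<infinity>}"

definition LpW_rel ::
    "(real^'n \<Rightarrow> real) \<Rightarrow> (real^'n \<Rightarrow> real^'m^'m) \<Rightarrow> (real^'n \<Rightarrow> real^'m) rel" where
  "LpW_rel p W =
     {(f, g). f \<in> LpW_fun p W \<and> g \<in> LpW_fun p W \<and> (AE x in lebesgue. f x = g x)}"

definition LpW ::
    "(real^'n \<Rightarrow> real) \<Rightarrow> (real^'n \<Rightarrow> real^'m^'m) \<Rightarrow> (real^'n \<Rightarrow> real^'m) set set" where
  "LpW p W = LpW_fun p W // LpW_rel p W"

definition LpW_class ::
    "(real^'n \<Rightarrow> real) \<Rightarrow> (real^'n \<Rightarrow> real^'m^'m) \<Rightarrow> (real^'n \<Rightarrow> real^'m) \<Rightarrow> (real^'n \<Rightarrow> real^'m) set"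
  where "LpW_class p W f = LpW_rel p W `` {f}"

text \<open>The norm does not see null sets, so the choice of representatives is immaterial.\<close>

definition LpW_dist ::
    "(real^'n \<Rightarrow> real) \<Rightarrow> (real^'n \<Rightarrow> real^'m^'m) \<Rightarrow>
     (real^'n \<Rightarrow> real^'m) set \<Rightarrow> (real^'n \<Rightarrow> real^'m) set \<Rightarrow> real" where
  "LpW_dist p W A B =
     enn2real (LpW_norm p W (\<lambda>x. (SOME f. f \<in> A) x - (SOME g. g \<in> B) x))"

definition LpW_topology ::
    "(real^'n \<Rightarrow> real) \<Rightarrow> (real^'n \<Rightarrow> real^'m^'m) \<Rightarrow> (real^'n \<Rightarrow> real^'m) set topology" where
  "LpW_topology p W = Metric_space.mtopology (LpW p W) (LpW_dist p W)"

text \<open>Precompact means having compact closure in the normed space; this implies total boundedness.\<close>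

definition LpW_precompact ::
    "(real^'n \<Rightarrow> real) \<Rightarrow> (real^'n \<Rightarrow> real^'m^'m) \<Rightarrow> (real^'n \<Rightarrow> real^'m) set set \<Rightarrow> bool" where
  "LpW_precompact p W S \<longleftrightarrow>
     compactin (LpW_topology p W) (LpW_topology p W closure_of S)"

definition translate :: "real^'n \<Rightarrow> (real^'n \<Rightarrow> real^'m) \<Rightarrow> real^'n \<Rightarrow> real^'m" where
  "translate y f = (\<lambda>x. f (x - y))"

end

theory Submission
  imports Defs "HOL-Probability.Probability_Measure"
begin

text \<open>
  Since \<open>L\<^bsup>p(.)\<^esup>(W)\<close> is complete, it suffices that \<open>\<F>\<close> is totally bounded.
  Let \<open>P f\<close> be the function that is constant on each cell of a grid of mesh \<open>l\<close>, with value the mean of \<open>f\<close>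
  over the closed cell.  Jensen's inequality at each point \<open>x\<close>, for the convex function \<open>u powr p x\<close>,
  followed by Tonelli's theorem gives, on any bounded union of cells,
  \<open>\<parallel>f - P f\<parallel> \<le> 2^n sup \<parallel>\<tau>\<^sub>y f - f\<parallel>\<close> over the \<open>y\<close> whose coordinates are at most \<open>l\<close> in absolute value;
  this is small by equicontinuity, and the part of \<open>f\<close> outside a large ball is small uniformly in \<open>f\<close>.
  The \<open>A\<^bsub>p(.)\<^esub>\<close> condition enters only locally: it makes \<open>|W\<^sup>-\<^sup>1|\<close> belong to \<open>L\<^bsup>p'(.)\<^esup>\<close> of every cube, so
  that Young's inequality bounds the means uniformly in \<open>f\<close>, and \<open>|W|\<close> belong to \<open>L\<^bsup>p(.)\<^esup>\<close> of every cube, so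
  that close means give close step functions.  Rounding the finitely many means to a finite net
  therefore splits \<open>\<F>\<close> into finitely many pieces of small diameter.
\<close>

subsection \<open>Modulars and Luxemburg norms\<close>

text \<open>For \<open>h \<ge> 0\<close> and \<open>0 < t\<close>, the bound
  \<open>modular p (\<lambda>x. h x / t) \<le> 1\<close> is exactly the admissibility of
  \<open>t\<close> in \<open>Lp_var_norm\<close>; stating it for real-valued integrands keeps powers
  of extended reals out of the estimates.\<close>

definition modular :: "(real^'n \<Rightarrow> real) \<Rightarrow> (real^'n \<Rightarrow> real) \<Rightarrow> ennreal" where
  "modular p h = (\<integral>\<^sup>+ x. ennreal (h x powr p x) \<partial>lebesgue)"

lemma ennreal_powr_mono:
  assumes "a \<le> b" "0 \<le> s"
  shows "ennreal_powr a s \<le> ennreal_powr b s"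
proof (cases "b = \<infinity>")
  case False
  then have "b < \<infinity>" "a < \<infinity>"
    using assms by (auto simp: less_top top_unique)
  then show ?thesis
    using assms False by (auto simp: ennreal_powr_def enn2real_mono intro!: ennreal_leI powr_mono2)
qed (simp add: ennreal_powr_def)

lemma ennreal_powr_divide:
  assumes "0 \<le> a" "0 < t"
  shows "ennreal_powr (ennreal a / ennreal t) s = ennreal ((a / t) powr s)"
  using assms by (simp add: ennreal_powr_def divide_ennreal)

text \<open>Young's inequality for \<open>t\<close> and \<open>a powr (s - 1)\<close>.\<close>

lemma powr_tangent_le:
  fixes a s t :: real
  assumes "1 < s" "0 \<le> a" "0 \<le> t"
  shows "s * a powr (s - 1) * t \<le> t powr s + (s - 1) * a powr s"
proof -
  have "t * a powr (s - 1) \<le> t powr s / s + (a powr (s - 1)) powr (s / (s - 1)) / (s / (s - 1))"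
    using assms by (intro Youngs_inequality) (auto simp: field_simps)
  also have "(a powr (s - 1)) powr (s / (s - 1)) = a powr s"
    using assms by (simp add: powr_powr)
  finally show ?thesis
    using assms by (simp add: field_simps)
qed

text \<open>The tangent inequality \<open>powr_tangent_le\<close> is used at the point
  \<open>a = u * x + v * y\<close>, once for \<open>x\<close> and once for \<open>y\<close>.
  Weighted by \<open>u\<close> and \<open>v\<close>, the linear terms add up to
  \<open>s * a powr s\<close>. The argument also covers vanishing \<open>x\<close>, \<open>y\<close>
  or \<open>a\<close>.\<close>

lemma powr_convex_nonneg:
  fixes u v x y s :: real
  assumes "1 < s" "0 \<le> x" "0 \<le> y" "0 \<le> u" "0 \<le> v" "u + v = 1"
  shows "(u * x + v * y) powr s \<le> u * x powr s + v * y powr s"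
proof -
  define a where "a = u * x + v * y"
  have a: "0 \<le> a"
    using assms by (simp add: a_def)
  have "u * (s * a powr (s - 1) * x) + v * (s * a powr (s - 1) * y)
      \<le> u * (x powr s + (s - 1) * a powr s) + v * (y powr s + (s - 1) * a powr s)"
    using assms a by (intro add_mono mult_left_mono powr_tangent_le) auto
  also have "\<dots> = u * x powr s + v * y powr s + (u + v) * ((s - 1) * a powr s)"
    by (simp add: algebra_simps)
  also have "u * (s * a powr (s - 1) * x) + v * (s * a powr (s - 1) * y)
      = s * (a powr (s - 1) * a)"
    unfolding a_def by (simp only: ring_distribs mult_ac)
  also have "a powr (s - 1) * a = a powr s"
    using a by (cases "a = 0") (auto simp: powr_diff)
  finally have "s * a powr s \<le> u * x powr s + v * y powr s + (s - 1) * a powr s"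
    using assms by simp
  then show ?thesis
    by (simp add: a_def left_diff_distrib)
qed

text \<open>Integrate the tangent inequality at the mean \<open>a\<close>. The right-hand side may
  be infinite, so the finite term \<open>(s - 1) * a powr s\<close> is kept on both sides and
  cancelled only at the end.\<close>

lemma (in prob_space) powr_jensen:
  fixes g :: "'a \<Rightarrow> real"
  assumes g: "integrable M g" "\<And>x. 0 \<le> g x" and s: "1 < s"
  shows "ennreal ((\<integral>x. g x \<partial>M) powr s) \<le> (\<integral>\<^sup>+ x. ennreal (g x powr s) \<partial>M)"
proof -
  define a where "a = (\<integral>x. g x \<partial>M)"
  have [measurable]: "g \<in> borel_measurable M" using g by auto
  have a: "0 \<le> a"
    using g by (simp add: a_def)
  have aa: "a powr (s - 1) * a = a powr s"
    using a by (cases "a = 0") (auto simp: powr_diff)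
  have "ennreal (a powr s) + ennreal ((s - 1) * a powr s) = ennreal (a powr s + (s - 1) * a powr s)"
    using s by (intro ennreal_plus[symmetric]) auto
  also have "a powr s + (s - 1) * a powr s = s * a powr (s - 1) * a"
    by (simp add: aa left_diff_distrib mult.assoc)
  also have "ennreal (s * a powr (s - 1) * a) = ennreal (s * a powr (s - 1)) * (\<integral>\<^sup>+ x. ennreal (g x) \<partial>M)"
    using g s a by (simp add: nn_integral_eq_integral a_def ennreal_mult)
  also have "\<dots> = (\<integral>\<^sup>+ x. ennreal (s * a powr (s - 1) * g x) \<partial>M)"
    using g s by (simp add: ennreal_mult nn_integral_cmult)
  also have "\<dots> \<le> (\<integral>\<^sup>+ x. ennreal (g x powr s) + ennreal ((s - 1) * a powr s) \<partial>M)"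
    using g s a powr_tangent_le[of s a]
    by (intro nn_integral_mono) (simp flip: ennreal_plus)
  also have "\<dots> = (\<integral>\<^sup>+ x. ennreal (g x powr s) \<partial>M) + ennreal ((s - 1) * a powr s)"
    by (simp add: nn_integral_add emeasure_space_1)
  finally show ?thesis
    by (simp add: a_def)
qed

text \<open>Both properties pass to the conjugate exponent, so the locale serves the inner and the
  outer norm of the characteristic alike.\<close>

locale variable_exponent =
  fixes p :: "real^'n \<Rightarrow> real"
  assumes exponent_measurable [measurable]: "p \<in> borel_measurable lebesgue"
    and exponent_gt_1: "AE x in lebesgue. 1 < p x"
begin

lemma Lp_var_norm_mono:
  assumes "AE x in lebesgue. f x \<le> g x"
  shows "Lp_var_norm p f \<le> Lp_var_norm p g"
  unfolding Lp_var_norm_def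
proof (rule Inf_superset_mono, safe)
  fix t :: real
  assume t: "0 < t" "(\<integral>\<^sup>+ x. ennreal_powr (g x / ennreal t) (p x) \<partial>lebesgue) \<le> 1"
  have "(\<integral>\<^sup>+ x. ennreal_powr (f x / ennreal t) (p x) \<partial>lebesgue)
      \<le> (\<integral>\<^sup>+ x. ennreal_powr (g x / ennreal t) (p x) \<partial>lebesgue)"
  proof (intro nn_integral_mono_AE, use assms exponent_gt_1 in eventually_elim)
    case (elim x)
    then show ?case
      by (intro ennreal_powr_mono divide_right_mono_ennreal) auto
  qed
  then show "\<exists>s. ennreal t = ennreal s \<and> 0 < s \<and>
      (\<integral>\<^sup>+ x. ennreal_powr (f x / ennreal s) (p x) \<partial>lebesgue) \<le> 1"
    using t by (intro exI[of _ t]) auto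
qed

lemma Lp_var_norm_cong:
  assumes "AE x in lebesgue. f x = g x"
  shows "Lp_var_norm p f = Lp_var_norm p g"
proof (rule antisym; rule Lp_var_norm_mono)
  show "AE x in lebesgue. f x \<le> g x" "AE x in lebesgue. g x \<le> f x"
    using assms by (eventually_elim, simp)+
qed

lemma modular_mono:
  assumes "AE x in lebesgue. g x \<le> h x" "\<And>x. 0 \<le> g x"
  shows "modular p g \<le> modular p h"
  unfolding modular_def
proof (intro nn_integral_mono_AE, use assms(1) exponent_gt_1 in eventually_elim)
  case (elim x)
  then show ?case
    using assms(2) by (intro ennreal_leI powr_mono2) auto
qed

lemma Lp_var_norm_le:
  assumes "\<And>x. 0 \<le> h x" "0 < t" "modular p (\<lambda>x. h x / t) \<le> 1"
  shows "Lp_var_norm p (\<lambda>x. ennreal (h x)) \<le> ennreal t"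
  unfolding Lp_var_norm_def using assms
  by (intro Inf_lower) (auto simp: modular_def ennreal_powr_divide)

text \<open>The strict inequality supplies an admissible \<open>s < t\<close>, and the modular
  decreases as the divisor grows; whether the infimum is attained is never asked.\<close>

lemma modular_le_1:
  assumes h: "\<And>x. 0 \<le> h x" and t: "Lp_var_norm p (\<lambda>x. ennreal (h x)) < ennreal t"
  shows "modular p (\<lambda>x. h x / t) \<le> 1"
proof -
  obtain s where s: "0 < s" "ennreal s < ennreal t"
      "(\<integral>\<^sup>+ x. ennreal_powr (ennreal (h x) / ennreal s) (p x) \<partial>lebesgue) \<le> 1"
    using t unfolding Lp_var_norm_def by (auto simp: Inf_less_iff)
  then have st: "s < t"
    by (simp add: ennreal_less_iff)
  have "modular p (\<lambda>x. h x / t) \<le> modular p (\<lambda>x. h x / s)"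
    using s(1) st h by (intro modular_mono AE_I2) (auto intro!: divide_left_mono)
  also have "\<dots> \<le> 1"
    using s h by (simp add: modular_def ennreal_powr_divide)
  finally show ?thesis .
qed

text \<open>Since \<open>1 < p x\<close> and \<open>1 \<le> K\<close>, the power
  \<open>K powr p x\<close> is at least \<open>K\<close>. This one-sided estimate replaces the
  homogeneity that a variable exponent destroys.\<close>

lemma modular_divide_le:
  assumes [measurable]: "h \<in> borel_measurable lebesgue"
    and h: "\<And>x. 0 \<le> h x" and K: "1 \<le> K"
  shows "modular p (\<lambda>x. h x / K) \<le> ennreal (1 / K) * modular p h"
proof -
  have "modular p (\<lambda>x. h x / K) \<le> (\<integral>\<^sup>+ x. ennreal (1 / K) * ennreal (h x powr p x) \<partial>lebesgue)"
    unfolding modular_def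
  proof (intro nn_integral_mono_AE, use exponent_gt_1 in eventually_elim)
    case (elim x)
    then have "K powr 1 \<le> K powr p x"
      using K by (intro powr_mono) auto
    then have "h x powr p x / K powr p x \<le> h x powr p x / K"
      using K by (intro divide_left_mono) auto
    then have "(h x / K) powr p x \<le> 1 / K * h x powr p x"
      using K h[of x] by (simp add: powr_divide)
    then show ?case
      using K by (simp add: ennreal_mult[symmetric] ennreal_leI)
  qed
  also have "\<dots> = ennreal (1 / K) * modular p h"
    unfolding modular_def by (intro nn_integral_cmult) measurable
  finally show ?thesis .
qed

lemma modular_scale:
  assumes "h \<in> borel_measurable lebesgue" "\<And>x. 0 \<le> h x" and K: "1 \<le> K" "modular p h \<le> ennreal K"
  shows "modular p (\<lambda>x. h x / K) \<le> 1"
proof -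
  have "modular p (\<lambda>x. h x / K) \<le> ennreal (1 / K) * modular p h"
    using assms by (intro modular_divide_le)
  also have "\<dots> \<le> ennreal (1 / K) * ennreal K"
    using K by (intro mult_left_mono) auto
  also have "\<dots> = 1"
    using K by (simp add: ennreal_mult[symmetric])
  finally show ?thesis .
qed

text \<open>A vanishing norm makes the modular of every positive multiple of \<open>h\<close> at
  most 1. Taking the multiple \<open>Suc n\<close> and dividing it out again shows that the modular
  of \<open>h\<close> is at most \<open>1 / Suc n\<close> for every \<open>n\<close>.\<close>

lemma Lp_var_norm_eq_0_imp_AE:
  assumes [measurable]: "h \<in> borel_measurable lebesgue"
    and h: "\<And>x. 0 \<le> h x" and eq_0: "Lp_var_norm p (\<lambda>x. ennreal (h x)) = 0"
  shows "AE x in lebesgue. h x = 0"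
proof -
  have "modular p h \<le> ennreal (1 / real (Suc n))" for n
  proof -
    let ?K = "real (Suc n)"
    have "modular p h = modular p (\<lambda>x. ?K * h x / ?K)"
      by simp
    also have "\<dots> \<le> ennreal (1 / ?K) * modular p (\<lambda>x. ?K * h x)"
      using h by (intro modular_divide_le) auto
    also have "modular p (\<lambda>x. ?K * h x) = modular p (\<lambda>x. h x / (1 / ?K))"
      by (simp add: mult.commute)
    also have "\<dots> \<le> 1"
      using h eq_0 by (intro modular_le_1) auto
    finally show ?thesis
      by (simp add: mult_left_mono)
  qed
  moreover have "(\<lambda>n. ennreal (1 / real (Suc n))) \<longlonglongrightarrow> ennreal 0"
    by (intro tendsto_ennrealI LIMSEQ_Suc lim_1_over_n)
  ultimately have "modular p h \<le> ennreal 0"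
    by (intro LIMSEQ_le_const) auto
  then have "(\<integral>\<^sup>+ x. ennreal (h x powr p x) \<partial>lebesgue) = 0"
    by (simp add: modular_def)
  then have "AE x in lebesgue. ennreal (h x powr p x) = 0"
    by (subst (asm) nn_integral_0_iff_AE) auto
  then show ?thesis
    by eventually_elim (use powr_gt_zero in force)
qed

text \<open>Let \<open>s\<close> and \<open>t\<close> exceed the two norms by \<open>e / 2\<close>.
  Then \<open>(g + h) / (s + t)\<close> is the convex combination of \<open>g / s\<close> and
  \<open>h / t\<close> with weights \<open>s / (s + t)\<close> and \<open>t / (s + t)\<close>, so
  pointwise convexity bounds its modular by 1.\<close>

lemma Lp_var_norm_triangle:
  assumes [measurable]: "g \<in> borel_measurable lebesgue" "h \<in> borel_measurable lebesgue"
    and nonneg: "\<And>x. 0 \<le> g x" "\<And>x. 0 \<le> h x" "\<And>x. 0 \<le> f x"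
    and le: "AE x in lebesgue. f x \<le> g x + h x"
  shows "Lp_var_norm p (\<lambda>x. ennreal (f x))
    \<le> Lp_var_norm p (\<lambda>x. ennreal (g x)) + Lp_var_norm p (\<lambda>x. ennreal (h x))"
proof (rule ennreal_le_epsilon)
  let ?a = "Lp_var_norm p (\<lambda>x. ennreal (g x))" and ?b = "Lp_var_norm p (\<lambda>x. ennreal (h x))"
  fix e :: real assume fin: "?a + ?b < top" and e: "0 < e"
  define s t where "s = enn2real ?a + e / 2" and "t = enn2real ?b + e / 2"
  have eq: "ennreal s = ?a + ennreal (e / 2)" "ennreal t = ?b + ennreal (e / 2)"
    using fin e by (simp_all add: s_def t_def ennreal_plus)
  have st: "0 < s" "0 < t" "?a < ennreal s" "?b < ennreal t"
    using e fin by (auto simp: s_def t_def add_nonneg_pos eq[unfolded s_def t_def])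
  have "ennreal (s + t) = ennreal s + ennreal t"
    using st by (intro ennreal_plus) auto
  also have "\<dots> = ?a + ?b + (ennreal (e / 2) + ennreal (e / 2))"
    by (simp add: eq ac_simps)
  also have "ennreal (e / 2) + ennreal (e / 2) = ennreal e"
    using e by (simp flip: ennreal_plus)
  finally have st_eq: "ennreal (s + t) = ?a + ?b + ennreal e" .
  have convex: "(f x / (s + t)) powr p x
      \<le> s / (s + t) * (g x / s) powr p x + t / (s + t) * (h x / t) powr p x"
    if "1 < p x" "f x \<le> g x + h x" for x
  proof -
    have "(s / (s + t) * (g x / s) + t / (s + t) * (h x / t)) powr p x
      \<le> s / (s + t) * (g x / s) powr p x + t / (s + t) * (h x / t) powr p x"
      using st nonneg that by (intro powr_convex_nonneg) (auto simp: add_divide_distrib[symmetric])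
    moreover have "s / (s + t) * (g x / s) + t / (s + t) * (h x / t) = (g x + h x) / (s + t)"
      using st by (simp add: add_divide_distrib)
    moreover have "(f x / (s + t)) powr p x \<le> ((g x + h x) / (s + t)) powr p x"
      using that st nonneg by (intro powr_mono2 divide_right_mono) auto
    ultimately show ?thesis by simp
  qed
  have "modular p (\<lambda>x. f x / (s + t))
    \<le> (\<integral>\<^sup>+ x. ennreal (s / (s + t)) * ennreal ((g x / s) powr p x)
        + ennreal (t / (s + t)) * ennreal ((h x / t) powr p x) \<partial>lebesgue)"
    unfolding modular_def
  proof (intro nn_integral_mono_AE, use exponent_gt_1 le in eventually_elim)
    case (elim x)
    then show ?case
      using st by (auto simp: ennreal_mult[symmetric] simp flip: ennreal_plus intro!: ennreal_leI dest!: convex)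
  qed
  also have "\<dots> = ennreal (s / (s + t)) * modular p (\<lambda>x. g x / s)
      + ennreal (t / (s + t)) * modular p (\<lambda>x. h x / t)"
    unfolding modular_def by (simp add: nn_integral_add nn_integral_cmult)
  also have "\<dots> \<le> ennreal (s / (s + t)) * 1 + ennreal (t / (s + t)) * 1"
    using st nonneg by (intro add_mono mult_left_mono modular_le_1) auto
  also have "\<dots> = 1"
    using st by (simp add: add_divide_distrib[symmetric] flip: ennreal_plus)
  finally have "Lp_var_norm p (\<lambda>x. ennreal (f x)) \<le> ennreal (s + t)"
    using st nonneg by (intro Lp_var_norm_le) auto
  then show "Lp_var_norm p (\<lambda>x. ennreal (f x)) \<le> ?a + ?b + ennreal e"
    by (simp add: st_eq)
qed

end

section \<open>Vector-valued measurability and operator norms of matrices\<close>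

lemma borel_measurable_vec:
  fixes f :: "'a \<Rightarrow> 'b::euclidean_space^'k"
  assumes "\<And>i. (\<lambda>x. f x $ i) \<in> borel_measurable M"
  shows "f \<in> borel_measurable M"
proof (subst borel_measurable_euclidean_space, safe)
  fix b :: "'b^'k" assume "b \<in> Basis"
  then obtain i u where b: "b = axis i u"
    by (auto simp: Basis_vec_def)
  show "(\<lambda>x. f x \<bullet> b) \<in> borel_measurable M"
    unfolding b inner_axis using assms by simp
qed

lemma borel_measurable_matrix_vector_mult [measurable]:
  fixes A :: "'a \<Rightarrow> real^'k^'l"
  assumes "A \<in> borel_measurable M" "f \<in> borel_measurable M"
  shows "(\<lambda>x. A x *v f x) \<in> borel_measurable M"
  using assms unfolding matrix_vector_mult_def
  by (intro borel_measurable_continuous_Pair[where H = "\<lambda>A v. \<chi> i. \<Sum>j\<in>UNIV. A $ i $ j * v $ j"]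
      continuous_intros)

lemma norm_matrix_vector_mult_le: "norm (A *v v) \<le> op_norm A * norm v"
  for A :: "real^'k^'k"
  unfolding op_norm_def by (rule onorm) (rule matrix_vector_mul_bounded_linear)

lemma op_norm_nonneg: "0 \<le> op_norm (A :: real^'k^'k)"
  unfolding op_norm_def by (rule onorm_pos_le) (rule matrix_vector_mul_bounded_linear)

lemma op_norm_matrix_mul: "op_norm (A ** B) \<le> op_norm A * op_norm (B :: real^'k^'k)"
proof -
  have "(*v) (A ** B) = (*v) A \<circ> (*v) B"
    by (simp add: fun_eq_iff matrix_vector_mul_assoc)
  then show ?thesis
    unfolding op_norm_def by (simp add: onorm_compose)
qed

lemma matrix_inv_mult:
  fixes A :: "real^'k^'k"
  assumes "invertible A"
  shows "A ** matrix_inv A = mat 1" "matrix_inv A ** A = mat 1"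
proof -
  have "\<exists>B. A ** B = mat 1 \<and> B ** A = mat 1"
    using assms by (simp add: invertible_def)
  then have "A ** matrix_inv A = mat 1 \<and> matrix_inv A ** A = mat 1"
    unfolding matrix_inv_def by (rule someI_ex)
  then show "A ** matrix_inv A = mat 1" "matrix_inv A ** A = mat 1" by auto
qed

lemma norm_le_op_norm_inv:
  fixes A :: "real^'k^'k"
  assumes "invertible A"
  shows "norm v \<le> op_norm (matrix_inv A) * norm (A *v v)"
proof -
  have "v = matrix_inv A *v (A *v v)"
    using assms by (simp add: matrix_vector_mul_assoc matrix_inv_mult)
  then show ?thesis
    by (metis norm_matrix_vector_mult_le)
qed

section \<open>The weighted norm of vector functions\<close>

locale weighted_exponent = variable_exponent p
  for p :: "real^'n \<Rightarrow> real" +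
  fixes W :: "real^'n \<Rightarrow> real^'m^'m"
  assumes weight: "matrix_weight W"
begin

text \<open>Each entry is the pointwise limit of its truncations to the balls of radius
  \<open>k\<close>, which are integrable, hence measurable, by local integrability.\<close>

lemma weight_measurable [measurable]: "W \<in> borel_measurable lebesgue"
proof (intro borel_measurable_vec)
  fix i j
  let ?u = "\<lambda>k x. indicator (cball 0 (real k)) x *\<^sub>R W x $ i $ j"
  have meas: "?u k \<in> borel_measurable lebesgue" for k
  proof -
    have "integrable lebesgue (?u k)"
      using weight compact_cball unfolding matrix_weight_def set_integrable_def by blast
    then show ?thesis by (rule borel_measurable_integrable)
  qed
  have "(\<lambda>k. ?u k x) \<longlonglongrightarrow> W x $ i $ j" for x
  proof (rule tendsto_eventually, rule eventually_sequentiallyI)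
    fix k assume "nat \<lceil>norm x\<rceil> \<le> k"
    then show "?u k x = W x $ i $ j"
      by (simp add: indicator_def)
  qed
  then show "(\<lambda>x. W x $ i $ j) \<in> borel_measurable lebesgue"
    using meas by (rule borel_measurable_LIMSEQ_real)
qed

lemma weight_invertible: "AE x in lebesgue. invertible (W x)"
  using weight by (simp add: matrix_weight_def)

lemma LpW_norm_triangle:
  assumes [measurable]: "f \<in> borel_measurable lebesgue" "g \<in> borel_measurable lebesgue"
    and "AE x in lebesgue. h x = f x + g x"
  shows "LpW_norm p W h \<le> LpW_norm p W f + LpW_norm p W g"
  unfolding LpW_norm_def
proof (rule Lp_var_norm_triangle)
  show "AE x in lebesgue. norm (W x *v h x) \<le> norm (W x *v f x) + norm (W x *v g x)"
    using assms(3) by eventually_elim (simp add: matrix_vector_right_distrib norm_triangle_ineq)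
qed auto

lemma LpW_norm_cong:
  assumes "AE x in lebesgue. f x = g x"
  shows "LpW_norm p W f = LpW_norm p W g"
  unfolding LpW_norm_def by (rule Lp_var_norm_cong) (use assms in eventually_elim, simp)

lemma LpW_norm_minus: "LpW_norm p W (\<lambda>x. - f x) = LpW_norm p W f"
proof -
  have "W x *v (- f x) = - (W x *v f x)" for x
    using matrix_vector_mult_scaleR[of "W x" "-1" "f x"] by simp
  then show ?thesis
    by (simp add: LpW_norm_def)
qed

lemma LpW_norm_minus_commute: "LpW_norm p W (\<lambda>x. f x - g x) = LpW_norm p W (\<lambda>x. g x - f x)"
  using LpW_norm_minus[of "\<lambda>x. g x - f x"] by simp

lemma LpW_norm_diff_triangle:
  assumes "f \<in> borel_measurable lebesgue" "g \<in> borel_measurable lebesgue"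
    "h \<in> borel_measurable lebesgue"
  shows "LpW_norm p W (\<lambda>x. f x - h x)
    \<le> LpW_norm p W (\<lambda>x. f x - g x) + LpW_norm p W (\<lambda>x. g x - h x)"
  using assms by (intro LpW_norm_triangle) auto

lemma LpW_norm_diff_le:
  assumes "f \<in> borel_measurable lebesgue" "g \<in> borel_measurable lebesgue"
  shows "LpW_norm p W (\<lambda>x. f x - g x) \<le> LpW_norm p W f + LpW_norm p W g"
  using LpW_norm_triangle[of f "\<lambda>x. - g x" "\<lambda>x. f x - g x"] assms by (simp add: LpW_norm_minus)

lemma LpW_norm_zero: "LpW_norm p W (\<lambda>x. 0) = 0"
proof -
  have "LpW_norm p W (\<lambda>x. 0) \<le> 0 + ennreal t" if "0 < t" for t
    unfolding LpW_norm_def using that by simp (rule Lp_var_norm_le[where h = "\<lambda>x. 0", simplified], auto simp: modular_def)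
  then have "LpW_norm p W (\<lambda>x. 0) \<le> 0"
    by (rule ennreal_le_epsilon)
  then show ?thesis by simp
qed

lemma LpW_norm_eq_0_imp_AE:
  assumes [measurable]: "f \<in> borel_measurable lebesgue" and "LpW_norm p W f = 0"
  shows "AE x in lebesgue. f x = 0"
proof -
  have "AE x in lebesgue. norm (W x *v f x) = 0"
    using assms(2) unfolding LpW_norm_def by (intro Lp_var_norm_eq_0_imp_AE) auto
  then show ?thesis
    using weight_invertible
  proof eventually_elim
    case (elim x)
    then show ?case
      using norm_le_op_norm_inv[of "W x" "f x"] by simp
  qed
qed

lemma LpW_fun_diff:
  assumes "f \<in> LpW_fun p W" "g \<in> LpW_fun p W"
  shows "(\<lambda>x. f x - g x) \<in> LpW_fun p W"
proof -
  have "LpW_norm p W (\<lambda>x. f x - g x) \<le> LpW_norm p W f + LpW_norm p W g"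
    using assms by (intro LpW_norm_diff_le) (auto simp: LpW_fun_def)
  also have "\<dots> < \<infinity>"
    using assms by (auto simp: LpW_fun_def ennreal_add_less_top)
  finally show ?thesis
    using assms by (auto simp: LpW_fun_def)
qed

end

subsection \<open>The space \<open>L\<^bsup>p(.)\<^esup>(W)\<close>\<close>

context weighted_exponent begin

lemma LpW_rel_equiv: "equiv (LpW_fun p W) (LpW_rel p W)"
proof (rule equivI)
  show "LpW_rel p W \<subseteq> LpW_fun p W \<times> LpW_fun p W"
    by (auto simp: LpW_rel_def)
  show "refl_on (LpW_fun p W) (LpW_rel p W)"
    by (auto simp: refl_on_def LpW_rel_def)
  show "sym (LpW_rel p W)"
    by (rule symI) (auto simp: LpW_rel_def elim: eventually_mono)
  show "trans (LpW_rel p W)"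
  proof (rule transI)
    fix f g h assume "(f, g) \<in> LpW_rel p W" "(g, h) \<in> LpW_rel p W"
    moreover from this have "AE x in lebesgue. f x = g x" "AE x in lebesgue. g x = h x"
      by (auto simp: LpW_rel_def)
    then have "AE x in lebesgue. f x = h x"
      by eventually_elim simp
    ultimately show "(f, h) \<in> LpW_rel p W"
      by (auto simp: LpW_rel_def)
  qed
qed

lemma LpW_classE:
  assumes "A \<in> LpW p W"
  obtains f where "f \<in> LpW_fun p W" "A = LpW_class p W f"
  using assms unfolding LpW_def LpW_class_def by (rule quotientE)

lemma LpW_class_in: "f \<in> LpW_fun p W \<Longrightarrow> LpW_class p W f \<in> LpW p W"
  unfolding LpW_def LpW_class_def by (rule quotientI)

lemma LpW_class_eq_iff:
  assumes "f \<in> LpW_fun p W" "g \<in> LpW_fun p W"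
  shows "LpW_class p W f = LpW_class p W g \<longleftrightarrow> (AE x in lebesgue. f x = g x)"
  unfolding LpW_class_def
  using eq_equiv_class_iff[OF LpW_rel_equiv assms] assms by (simp add: LpW_rel_def)

text \<open>\<open>LpW_dist\<close> picks representatives with \<open>SOME\<close>; this allows them
  to be exchanged for any given ones.\<close>

lemma LpW_class_some:
  assumes "f \<in> LpW_fun p W"
  shows "AE x in lebesgue. f x = (SOME g. g \<in> LpW_class p W f) x"
proof -
  have "f \<in> LpW_class p W f"
    using assms by (auto simp: LpW_class_def LpW_rel_def)
  then have "(SOME g. g \<in> LpW_class p W f) \<in> LpW_class p W f"
    by (rule someI[where P = "\<lambda>g. g \<in> LpW_class p W f"])
  then show ?thesis
    by (auto simp: LpW_class_def LpW_rel_def)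
qed

lemma LpW_dist_class:
  assumes "f \<in> LpW_fun p W" "g \<in> LpW_fun p W"
  shows "LpW_dist p W (LpW_class p W f) (LpW_class p W g) = enn2real (LpW_norm p W (\<lambda>x. f x - g x))"
  unfolding LpW_dist_def
  by (intro arg_cong[where f = enn2real] LpW_norm_cong,
      use LpW_class_some[OF assms(1)] LpW_class_some[OF assms(2)] in eventually_elim) simp

lemma ennreal_LpW_dist_class:
  assumes "f \<in> LpW_fun p W" "g \<in> LpW_fun p W"
  shows "ennreal (LpW_dist p W (LpW_class p W f) (LpW_class p W g)) = LpW_norm p W (\<lambda>x. f x - g x)"
  unfolding LpW_dist_class[OF assms] using LpW_fun_diff[OF assms] by (auto simp: LpW_fun_def)

lemma LpW_dist_nonneg: "0 \<le> LpW_dist p W A B"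
  by (simp add: LpW_dist_def)

lemma LpW_Metric_space: "Metric_space (LpW p W) (LpW_dist p W)"
proof
  fix A B
  show "0 \<le> LpW_dist p W A B"
    by (rule LpW_dist_nonneg)
  show "LpW_dist p W A B = LpW_dist p W B A"
    unfolding LpW_dist_def by (subst LpW_norm_minus_commute) (rule refl)
next
  fix A B assume "A \<in> LpW p W" "B \<in> LpW p W"
  then obtain f g where fg: "f \<in> LpW_fun p W" "g \<in> LpW_fun p W"
      "A = LpW_class p W f" "B = LpW_class p W g"
    by (metis LpW_classE)
  have [measurable]: "f \<in> borel_measurable lebesgue" "g \<in> borel_measurable lebesgue"
    using fg by (auto simp: LpW_fun_def)
  have "LpW_dist p W A B = 0 \<longleftrightarrow> LpW_norm p W (\<lambda>x. f x - g x) = 0"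
    using ennreal_LpW_dist_class[OF fg(1,2)] LpW_dist_nonneg[of A B]
    by (metis ennreal_eq_0_iff fg(3,4) order_antisym order_refl)
  also have "\<dots> \<longleftrightarrow> (AE x in lebesgue. f x = g x)"
  proof
    assume "LpW_norm p W (\<lambda>x. f x - g x) = 0"
    then have "AE x in lebesgue. f x - g x = 0"
      by (intro LpW_norm_eq_0_imp_AE) auto
    then show "AE x in lebesgue. f x = g x"
      by simp
  next
    assume eq: "AE x in lebesgue. f x = g x"
    have "LpW_norm p W (\<lambda>x. f x - g x) = LpW_norm p W (\<lambda>x. 0)"
      by (rule LpW_norm_cong) (use eq in eventually_elim, simp)
    then show "LpW_norm p W (\<lambda>x. f x - g x) = 0"
      by (simp add: LpW_norm_zero)
  qed
  also have "\<dots> \<longleftrightarrow> A = B"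
    using fg by (simp add: LpW_class_eq_iff)
  finally show "LpW_dist p W A B = 0 \<longleftrightarrow> A = B" .
next
  fix A B C assume "A \<in> LpW p W" "B \<in> LpW p W" "C \<in> LpW p W"
  then obtain f g h where fgh: "f \<in> LpW_fun p W" "g \<in> LpW_fun p W" "h \<in> LpW_fun p W"
      "A = LpW_class p W f" "B = LpW_class p W g" "C = LpW_class p W h"
    by (metis LpW_classE)
  have "ennreal (LpW_dist p W A C) \<le> ennreal (LpW_dist p W A B) + ennreal (LpW_dist p W B C)"
    using fgh by (simp add: ennreal_LpW_dist_class LpW_norm_diff_triangle LpW_fun_def)
  then show "LpW_dist p W A C \<le> LpW_dist p W A B + LpW_dist p W B C"
    using LpW_dist_nonneg[of A B] LpW_dist_nonneg[of B C]
    by (metis add_nonneg_nonneg ennreal_le_iff ennreal_plus)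
qed

lemma LpW_dist_class_less_iff:
  assumes "f \<in> LpW_fun p W" "g \<in> LpW_fun p W" "0 < e"
  shows "LpW_dist p W (LpW_class p W f) (LpW_class p W g) < e
    \<longleftrightarrow> LpW_norm p W (\<lambda>x. f x - g x) < ennreal e"
  using assms(3) LpW_dist_nonneg
  by (simp flip: ennreal_LpW_dist_class[OF assms(1,2)] add: ennreal_less_iff)

section \<open>Completeness\<close>

text \<open>Lower semicontinuity of the norm under convergence almost everywhere: Fatou's lemma for
  the modulars at the fixed level \<open>t\<close>, all but finitely many of which are at most
  1.\<close>

lemma LpW_fatou:
  assumes [measurable]: "\<And>k. f k \<in> borel_measurable lebesgue"
    and lim: "AE x in lebesgue. (\<lambda>k. f k x) \<longlonglongrightarrow> g x"
    and small: "eventually (\<lambda>k. LpW_norm p W (f k) < ennreal t) sequentially"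
  shows "LpW_norm p W g \<le> ennreal t"
proof -
  have t: "0 < t"
    using eventually_happens[OF small] by (cases "0 < t") (auto simp: ennreal_neg not_less)
  let ?h = "\<lambda>k x. norm (W x *v f k x) / t"
  have "modular p (\<lambda>x. norm (W x *v g x) / t)
      = (\<integral>\<^sup>+ x. liminf (\<lambda>k. ennreal (?h k x powr p x)) \<partial>lebesgue)"
    unfolding modular_def
  proof (intro nn_integral_cong_AE, use lim exponent_gt_1 in eventually_elim)
    case (elim x)
    have "(\<lambda>k. W x *v f k x) \<longlonglongrightarrow> W x *v g x"
      by (rule bounded_linear.tendsto[OF matrix_vector_mul_bounded_linear elim(1)])
    \<comment> \<open>The limit of the base may be 0; continuity of the power survives there because
      the exponent is positive.\<close>
    then have "(\<lambda>k. ?h k x powr p x) \<longlonglongrightarrow> (norm (W x *v g x) / t) powr p x"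
      using t elim(2) by (intro tendsto_powr' tendsto_intros) auto
    then show ?case
      by (intro lim_imp_Liminf[symmetric] tendsto_ennrealI) auto
  qed
  also have "\<dots> \<le> liminf (\<lambda>k. modular p (?h k))"
    unfolding modular_def by (intro nn_integral_liminf) measurable
  also have "\<dots> \<le> limsup (\<lambda>k. modular p (?h k))"
    by (intro Liminf_le_Limsup) simp
  also have "\<dots> \<le> 1"
    by (rule Limsup_bounded, use small in eventually_elim)
      (auto simp: LpW_norm_def intro!: modular_le_1)
  finally show ?thesis
    unfolding LpW_norm_def using t by (intro Lp_var_norm_le) auto
qed

text \<open>The decay \<open>1 / 4 ^ k\<close> is spent in two halves. One factor
  \<open>1 / 2 ^ k\<close> makes the modulars of \<open>2 ^ k * h k\<close> summable, so that
  \<open>2 ^ k * h k x\<close> is eventually at most 1 for almost every \<open>x\<close>. The other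
  is left as a geometric bound on \<open>h k x\<close>, and multiplication by the norm of the
  inverse matrix turns it into absolute summability of the increments.\<close>

lemma LpW_AE_convergent:
  assumes F [measurable]: "\<And>k. F k \<in> borel_measurable lebesgue"
    and small: "\<And>k. LpW_norm p W (\<lambda>x. F (Suc k) x - F k x) < ennreal (1 / 4 ^ k)"
  shows "AE x in lebesgue. convergent (\<lambda>k. F k x)"
proof -
  define h where "h k x = norm (W x *v (F (Suc k) x - F k x))" for k x
  have h [measurable]: "h k \<in> borel_measurable lebesgue" for k
    unfolding h_def by measurable
  have h0: "0 \<le> h k x" for k x
    by (simp add: h_def)
  have le: "modular p (\<lambda>x. 2 ^ k * h k x) \<le> ennreal ((1 / 2) ^ k)" for k
  proof -
    have "modular p (\<lambda>x. 2 ^ k * h k x) = modular p (\<lambda>x. (h k x / (1 / 4 ^ k)) / 2 ^ k)"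
      by (rule arg_cong[where f = "modular p"])
        (simp add: fun_eq_iff power_mult_distrib[symmetric] field_simps flip: power_mult_distrib)
    also have "\<dots> \<le> ennreal (1 / 2 ^ k) * modular p (\<lambda>x. h k x / (1 / 4 ^ k))"
      using h0 by (intro modular_divide_le) auto
    also have "modular p (\<lambda>x. h k x / (1 / 4 ^ k)) \<le> 1"
      using small[of k] h0 by (intro modular_le_1) (auto simp: LpW_norm_def h_def)
    finally show ?thesis
      by (simp add: power_one_over mult_left_mono)
  qed
  have "(\<integral>\<^sup>+ x. (\<Sum>k. ennreal ((2 ^ k * h k x) powr p x)) \<partial>lebesgue)
      = (\<Sum>k. modular p (\<lambda>x. 2 ^ k * h k x))"
    unfolding modular_def by (intro nn_integral_suminf) measurable
  also have "\<dots> \<le> (\<Sum>k. ennreal ((1 / 2) ^ k))"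
    using le by (intro suminf_le) auto
  also have "\<dots> = ennreal (\<Sum>k. (1 / 2) ^ k)"
    by (intro suminf_ennreal2) (auto simp: summable_geometric)
  finally have "(\<integral>\<^sup>+ x. (\<Sum>k. ennreal ((2 ^ k * h k x) powr p x)) \<partial>lebesgue) \<noteq> \<infinity>"
    by (auto simp: top_unique)
  then have "AE x in lebesgue. (\<Sum>k. ennreal ((2 ^ k * h k x) powr p x)) \<noteq> \<infinity>"
    by (intro nn_integral_noteq_infinite) measurable
  then show ?thesis
    using weight_invertible exponent_gt_1
  proof eventually_elim
    case (elim x)
    then have "summable (\<lambda>k. (2 ^ k * h k x) powr p x)"
      by (intro summable_suminf_not_top) auto
    then have "(\<lambda>k. (2 ^ k * h k x) powr p x) \<longlonglongrightarrow> 0"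
      by (rule summable_LIMSEQ_zero)
    then have "eventually (\<lambda>k. (2 ^ k * h k x) powr p x < 1) sequentially"
      by (rule order_tendstoD) simp
    then have "eventually (\<lambda>k. norm (F (Suc k) x - F k x)
        \<le> op_norm (matrix_inv (W x)) * (1 / 2) ^ k) sequentially"
    proof eventually_elim
      fix k assume k: "(2 ^ k * h k x) powr p x < 1"
      have "2 ^ k * h k x \<le> 1"
      proof (rule ccontr)
        assume "\<not> 2 ^ k * h k x \<le> 1"
        then have "1 \<le> (2 ^ k * h k x) powr p x"
          using elim(3) by (intro ge_one_powr_ge_zero) auto
        with k show False by simp
      qed
      then have "h k x \<le> (1 / 2) ^ k"
        by (simp add: field_simps)
      then have "op_norm (matrix_inv (W x)) * h k x \<le> op_norm (matrix_inv (W x)) * (1 / 2) ^ k"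
        by (intro mult_left_mono op_norm_nonneg)
      then show "norm (F (Suc k) x - F k x) \<le> op_norm (matrix_inv (W x)) * (1 / 2) ^ k"
        using norm_le_op_norm_inv[OF elim(2), of "F (Suc k) x - F k x"] by (simp add: h_def)
    qed
    then have "summable (\<lambda>k. F (Suc k) x - F k x)"
      by (rule summable_comparison_test_ev) (simp add: summable_mult summable_geometric)
    then have "convergent (\<lambda>k. \<Sum>i<k. F (Suc i) x - F i x)"
      by (simp add: summable_iff_convergent)
    then have "convergent (\<lambda>k. F k x - F 0 x)"
      by (simp add: sum_lessThan_telescope[of "\<lambda>k. F k x"])
    then have "convergent (\<lambda>k. F k x - F 0 x + F 0 x)"
      by (intro convergent_add convergent_const)
    then show ?case
      by simp
  qed
qed

text \<open>The Riesz-Fischer argument: a rapidly Cauchy subsequence converges almost everywhere,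
  and \<open>LpW_fatou\<close> carries the Cauchy bound over to the limit.\<close>

lemma LpW_complete:
  fixes f :: "nat \<Rightarrow> real^'n \<Rightarrow> real^'m"
  assumes f: "\<And>n. f n \<in> LpW_fun p W"
    and Cauchy: "\<And>e::real. 0 < e \<Longrightarrow>
      \<exists>N. \<forall>n\<ge>N. \<forall>k\<ge>N. LpW_norm p W (\<lambda>x. f n x - f k x) < ennreal e"
  obtains g where "g \<in> LpW_fun p W"
    "\<And>e::real. 0 < e \<Longrightarrow> \<exists>N. \<forall>n\<ge>N. LpW_norm p W (\<lambda>x. f n x - g x) \<le> ennreal e"
proof -
  have [measurable]: "f n \<in> borel_measurable lebesgue" for n
    using f by (auto simp: LpW_fun_def)
  have "\<forall>i. \<exists>N. \<forall>n\<ge>N. \<forall>k\<ge>N. LpW_norm p W (\<lambda>x. f n x - f k x) < ennreal (1 / 4 ^ i)"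
    by (intro allI Cauchy) simp
  then obtain N where N: "\<And>i n k. N i \<le> n \<Longrightarrow> N i \<le> k \<Longrightarrow>
      LpW_norm p W (\<lambda>x. f n x - f k x) < ennreal (1 / 4 ^ i)"
    by metis
  \<comment> \<open>The sum makes \<open>r\<close> monotone with \<open>N k \<le> r k\<close>, so
    the terms \<open>r k\<close> and \<open>r (Suc k)\<close> both lie beyond \<open>N k\<close>;
    the summand \<open>k\<close> drives \<open>r\<close> to infinity.\<close>
  define r where "r k = (\<Sum>i\<le>k. N i) + k" for k
  have r: "N k \<le> r k" "r k \<le> r (Suc k)" "k \<le> r k" for k
    by (auto simp: r_def intro: order_trans[OF member_le_sum[of k "{..k}" N]])
  \<comment> \<open>Where the subsequence diverges, \<open>lim\<close> returns an unspecified value;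
    this concerns only a null set.\<close>
  define g where "g x = lim (\<lambda>k. f (r k) x)" for x
  have [measurable]: "g \<in> borel_measurable lebesgue"
    unfolding g_def by (intro borel_measurable_lim_metric) measurable
  have "AE x in lebesgue. convergent (\<lambda>k. f (r k) x)"
    using r by (intro LpW_AE_convergent N) (auto intro: order_trans)
  then have lim: "AE x in lebesgue. (\<lambda>k. f (r k) x) \<longlonglongrightarrow> g x"
    by eventually_elim (simp add: g_def convergent_LIMSEQ_iff)
  have close: "\<exists>N. \<forall>n\<ge>N. LpW_norm p W (\<lambda>x. f n x - g x) \<le> ennreal e" if e: "0 < e" for e :: real
  proof -
    obtain M where M: "\<And>n k. M \<le> n \<Longrightarrow> M \<le> k \<Longrightarrow> LpW_norm p W (\<lambda>x. f n x - f k x) < ennreal e"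
      using Cauchy[OF e] by blast
    have "LpW_norm p W (\<lambda>x. f n x - g x) \<le> ennreal e" if "M \<le> n" for n
    proof (rule LpW_fatou)
      show "AE x in lebesgue. (\<lambda>k. f n x - f (r k) x) \<longlonglongrightarrow> f n x - g x"
        using lim by eventually_elim (intro tendsto_intros)
      show "eventually (\<lambda>k. LpW_norm p W (\<lambda>x. f n x - f (r k) x) < ennreal e) sequentially"
        by (rule eventually_sequentiallyI[of M]) (use that r(3) M order_trans in blast)
    qed measurable
    then show ?thesis by blast
  qed
  obtain n where n: "LpW_norm p W (\<lambda>x. f n x - g x) \<le> ennreal 1"
    using close[of 1] by auto
  have "LpW_norm p W g \<le> LpW_norm p W (f n) + LpW_norm p W (\<lambda>x. g x - f n x)"
    by (intro LpW_norm_triangle) auto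
  also have "\<dots> < \<infinity>"
    using n f[of n] le_less_trans[OF n, of \<infinity>]
    by (auto simp: LpW_fun_def ennreal_add_less_top LpW_norm_minus_commute[of g])
  finally have "g \<in> LpW_fun p W"
    by (simp add: LpW_fun_def)
  then show thesis
    using close by (rule that)
qed

lemma LpW_mcomplete: "Metric_space.mcomplete (LpW p W) (LpW_dist p W)"
proof -
  interpret Metric_space "LpW p W" "LpW_dist p W"
    by (rule LpW_Metric_space)
  show ?thesis
    unfolding mcomplete_def
  proof safe
    fix A assume "MCauchy A"
    then have A: "\<And>n. A n \<in> LpW p W"
        and Cauchy: "\<And>e. 0 < e \<Longrightarrow> \<exists>N. \<forall>n\<ge>N. \<forall>k\<ge>N. LpW_dist p W (A n) (A k) < e"
      by (auto simp: MCauchy_def)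
    have "\<forall>n. \<exists>f. f \<in> LpW_fun p W \<and> A n = LpW_class p W f"
      using A by (metis LpW_classE)
    then obtain f where f: "\<And>n. f n \<in> LpW_fun p W" "\<And>n. A n = LpW_class p W (f n)"
      by metis
    have Cauchy_f: "\<exists>N. \<forall>n\<ge>N. \<forall>k\<ge>N. LpW_norm p W (\<lambda>x. f n x - f k x) < ennreal e" if "0 < e" for e
      using Cauchy[OF that] f that by (simp add: LpW_dist_class_less_iff)
    obtain g where g: "g \<in> LpW_fun p W"
      "\<And>e::real. 0 < e \<Longrightarrow> \<exists>N. \<forall>n\<ge>N. LpW_norm p W (\<lambda>x. f n x - g x) \<le> ennreal e"
      using LpW_complete[OF f(1) Cauchy_f] by blast
    have "eventually (\<lambda>n. A n \<in> LpW p W \<and> LpW_dist p W (A n) (LpW_class p W g) < e) sequentially"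
      if e: "0 < e" for e
    proof -
      obtain N where "\<And>n. N \<le> n \<Longrightarrow> LpW_norm p W (\<lambda>x. f n x - g x) \<le> ennreal (e / 2)"
        using g(2)[of "e / 2"] e by auto
      moreover have "ennreal (e / 2) < ennreal e"
        using e by (simp add: ennreal_less_iff)
      ultimately have "\<And>n. N \<le> n \<Longrightarrow> LpW_norm p W (\<lambda>x. f n x - g x) < ennreal e"
        using le_less_trans by blast
      then show ?thesis
        using e f g(1) A by (auto simp: eventually_sequentially LpW_dist_class_less_iff)
    qed
    then have "limitin mtopology A (LpW_class p W g) sequentially"
      using LpW_class_in[OF g(1)] by (simp add: limitin_metric)
    then show "\<exists>B. limitin mtopology A B sequentially" ..
  qed
qed

end

subsection \<open>Consequences of the \<open>A\<^bsub>p(.)\<^esub>\<close> condition\<close>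

lemma emeasure_cube:
  fixes a :: "real^'n"
  assumes "0 \<le> l"
  shows "emeasure lebesgue (cbox a (a + vec l)) = ennreal (l ^ CARD('n))"
proof -
  have "a \<in> cbox a (a + vec l)"
    using assms by (simp add: mem_box_cart)
  then have "measure lborel (cbox a (a + vec l)) = l ^ CARD('n)"
    by (subst content_cbox_cart) auto
  moreover have "emeasure lborel (cbox a (a + vec l)) \<noteq> top"
    using emeasure_lborel_cbox_finite[of a "a + vec l"] by auto
  ultimately show ?thesis
    using emeasure_eq_ennreal_measure[of lborel "cbox a (a + vec l)"] by simp
qed

lemma cube_props:
  fixes Q :: "(real^'n) set"
  assumes "Q \<in> cubes"
  shows "Q \<in> sets lebesgue" "emeasure lebesgue Q \<noteq> 0" "emeasure lebesgue Q < \<infinity>"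
proof -
  obtain a l where Q: "Q = cbox a (a + vec l)" "0 < (l::real)"
    using assms by (auto simp: cubes_def)
  then have "emeasure lebesgue Q = ennreal (l ^ CARD('n))"
    using emeasure_cube[of l a] by simp
  then show "emeasure lebesgue Q \<noteq> 0" "emeasure lebesgue Q < \<infinity>"
    using Q(2) by auto
  show "Q \<in> sets lebesgue"
    by (simp add: Q(1))
qed

context variable_exponent begin

lemma variable_exponent_conjugate: "variable_exponent (conjugate_exponent p)"
proof
  show "conjugate_exponent p \<in> borel_measurable lebesgue"
    unfolding conjugate_exponent_def by measurable
  show "AE x in lebesgue. 1 < conjugate_exponent p x"
    using exponent_gt_1 by eventually_elim (simp add: conjugate_exponent_def)
qed

lemma Lp_var_norm_cmult_finite:
  assumes "0 < c" "Lp_var_norm p f < \<infinity>"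
  shows "Lp_var_norm p (\<lambda>x. ennreal c * f x) < \<infinity>"
proof -
  obtain t where t: "0 < t" "(\<integral>\<^sup>+ x. ennreal_powr (f x / ennreal t) (p x) \<partial>lebesgue) \<le> 1"
    using assms(2) unfolding Lp_var_norm_def by (auto simp: Inf_less_iff)
  have "ennreal c * f x / ennreal (c * t) = f x / ennreal t" for x
    using assms(1) t(1)
    by (cases "f x") (auto simp: ennreal_mult[symmetric] divide_ennreal ennreal_mult_top ennreal_top_divide)
  then have "Lp_var_norm p (\<lambda>x. ennreal c * f x) \<le> ennreal (c * t)"
    unfolding Lp_var_norm_def using assms(1) t by (intro Inf_lower) auto
  also have "\<dots> < \<infinity>"
    by simp
  finally show ?thesis .
qed

text \<open>No measurability of \<open>N\<close> is assumed: its integral is a lower integral, so finiteness of \<open>N\<close>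
  can only be concluded at some points of \<open>Q\<close>, not at almost all of them.\<close>

lemma Lp_var_norm_finite_point:
  assumes "Lp_var_norm p (\<lambda>x. N x * indicator Q x) < \<infinity>"
    and Q: "Q \<in> sets lebesgue" "emeasure lebesgue Q \<noteq> 0" and "AE x in lebesgue. P x"
  obtains x where "x \<in> Q" "P x" "N x < \<infinity>"
proof (rule ccontr)
  assume "\<not> thesis"
  then have N: "N x = \<infinity>" if "x \<in> Q" "P x" for x
    using that \<open>\<And>x. x \<in> Q \<Longrightarrow> P x \<Longrightarrow> N x < \<infinity> \<Longrightarrow> thesis\<close>[of x] by (auto simp: less_top[symmetric])
  obtain t where t: "0 < t"
      "(\<integral>\<^sup>+ x. ennreal_powr (N x * indicator Q x / ennreal t) (p x) \<partial>lebesgue) \<le> 1"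
    using assms(1) unfolding Lp_var_norm_def by (auto simp: Inf_less_iff)
  have "(\<infinity> :: ennreal) = \<infinity> * emeasure lebesgue Q"
    using Q(2) by (simp add: ennreal_top_mult)
  also have "\<dots> = (\<integral>\<^sup>+ x. \<infinity> * indicator Q x \<partial>lebesgue)"
    using Q(1) by (rule nn_integral_cmult_indicator[symmetric])
  also have "\<dots> \<le> (\<integral>\<^sup>+ x. ennreal_powr (N x * indicator Q x / ennreal t) (p x) \<partial>lebesgue)"
  proof (intro nn_integral_mono_AE, use assms(4) in eventually_elim)
    case (elim x)
    then show ?case
      using N[of x] by (cases "x \<in> Q") (auto simp: ennreal_top_divide ennreal_powr_def)
  qed
  finally show False
    using t by (auto simp: top_unique)
qed

end

context weighted_exponent begin

abbreviation (input) "q \<equiv> conjugate_exponent p"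

interpretation conj: variable_exponent q
  by (rule variable_exponent_conjugate)

lemma Ap_finite_on_cube:
  assumes "Ap_characteristic p W < \<infinity>" "Q \<in> cubes"
  shows "Lp_var_norm p (\<lambda>x. Lp_var_norm q
      (\<lambda>y. ennreal (op_norm (W x ** matrix_inv (W y))) * indicator Q y) * indicator Q x) < \<infinity>"
    (is "?L < \<infinity>")
proof -
  have "?L / emeasure lebesgue Q \<le> Ap_characteristic p W"
    unfolding Ap_characteristic_def using assms(2) by (intro SUP_upper)
  then have "?L / emeasure lebesgue Q < \<infinity>"
    using assms(1) by (rule le_less_trans)
  then show ?thesis
    using cube_props(3)[OF assms(2)] by (auto simp: less_top[symmetric] ennreal_divide_eq_top_iff)
qed

text \<open>Freeze one point \<open>x\<close> of the cube at which \<open>W x\<close> is invertible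
  and the inner norm is finite, and write the inverse of \<open>W y\<close> as
  \<open>matrix_inv (W x) ** (W x ** matrix_inv (W y))\<close>.\<close>

lemma inverse_weight_local:
  assumes "Ap_characteristic p W < \<infinity>" "Q \<in> cubes"
  shows "Lp_var_norm q (\<lambda>y. ennreal (op_norm (matrix_inv (W y))) * indicator Q y) < \<infinity>"
proof -
  obtain x where x: "invertible (W x)"
    "Lp_var_norm q (\<lambda>y. ennreal (op_norm (W x ** matrix_inv (W y))) * indicator Q y) < \<infinity>"
    using Lp_var_norm_finite_point[OF Ap_finite_on_cube[OF assms] cube_props(1,2)[OF assms(2)]
        weight_invertible]
    by blast
  \<comment> \<open>The summand 1 makes the constant positive, as
    \<open>Lp_var_norm_cmult_finite\<close> requires.\<close>
  let ?c = "op_norm (matrix_inv (W x)) + 1"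
  have le: "op_norm (matrix_inv (W y)) \<le> ?c * op_norm (W x ** matrix_inv (W y))" for y
  proof -
    have "matrix_inv (W y) = matrix_inv (W x) ** (W x ** matrix_inv (W y))"
      using x(1) by (simp add: matrix_mul_assoc matrix_inv_mult)
    then have "op_norm (matrix_inv (W y)) \<le> op_norm (matrix_inv (W x)) * op_norm (W x ** matrix_inv (W y))"
      by (metis op_norm_matrix_mul)
    then show ?thesis
      using op_norm_nonneg[of "W x ** matrix_inv (W y)"] by (simp add: distrib_right)
  qed
  have "ennreal (op_norm (matrix_inv (W y)))
      \<le> ennreal ?c * ennreal (op_norm (W x ** matrix_inv (W y)))" for y
    using ennreal_leI[OF le[of y]] by (simp add: ennreal_mult op_norm_nonneg)
  then have "Lp_var_norm q (\<lambda>y. ennreal (op_norm (matrix_inv (W y))) * indicator Q y)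
    \<le> Lp_var_norm q (\<lambda>y. ennreal ?c * (ennreal (op_norm (W x ** matrix_inv (W y))) * indicator Q y))"
    by (intro conj.Lp_var_norm_mono AE_I2) (auto simp: indicator_def)
  also have "\<dots> < \<infinity>"
    using x(2) op_norm_nonneg[of "matrix_inv (W x)"] by (intro conj.Lp_var_norm_cmult_finite) auto
  finally show ?thesis .
qed

text \<open>The sets where the entries of \<open>W x\<close> have absolute sum at most
  \<open>k\<close> exhaust \<open>Q\<close>, so one of them meets \<open>Q\<close> in positive
  measure. The entry sum is measurable at once and dominates the operator norm.\<close>

lemma weight_bounded_on_subset:
  assumes Q: "Q \<in> sets lebesgue" "emeasure lebesgue Q \<noteq> 0"
  obtains E and M :: real where "E \<in> sets lebesgue" "E \<subseteq> Q" "emeasure lebesgue E \<noteq> 0" "0 < M"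
    "\<And>x. x \<in> E \<Longrightarrow> op_norm (W x) \<le> M"
proof -
  let ?s = "\<lambda>x. \<Sum>i\<in>UNIV. \<Sum>j\<in>UNIV. \<bar>W x $ i $ j\<bar>"
  have entry [measurable]: "(\<lambda>x. W x $ i $ j) \<in> borel_measurable lebesgue" for i j
    by (intro measurable_compose[OF weight_measurable] borel_measurable_continuous_onI continuous_intros)
  define E where "E k = {x \<in> space lebesgue. ?s x \<le> real k} \<inter> Q" for k
  have E: "E k \<in> sets lebesgue" for k
    unfolding E_def using Q(1) by (intro sets.Int) measurable
  have "Q = (\<Union>k. E k)"
    by (auto simp: E_def real_arch_simple)
  then obtain k where k: "emeasure lebesgue (E k) \<noteq> 0"
    using Q(2) E null_sets_UN[of E lebesgue] by (auto simp: null_sets_def)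
  show thesis
  proof (rule that[OF E _ k])
    fix x assume "x \<in> E k"
    then show "op_norm (W x) \<le> real k + 1"
      using onorm_le_matrix_component_sum[of "W x"] by (auto simp: E_def op_norm_def)
  qed (auto simp: E_def)
qed

text \<open>For almost every \<open>y\<close> in the set \<open>E\<close> where the weight is
  bounded by \<open>M\<close>, the norm of \<open>W x\<close> is at most \<open>M\<close> times that
  of \<open>W x ** matrix_inv (W y)\<close>. The inner norm at \<open>x\<close> therefore dominates
  a constant multiple of the norm of \<open>W x\<close>, and the outer norm of the inner one is
  finite.\<close>

lemma weight_local:
  assumes "Ap_characteristic p W < \<infinity>" "Q \<in> cubes"
  shows "Lp_var_norm p (\<lambda>x. ennreal (op_norm (W x)) * indicator Q x) < \<infinity>"
proof -
  obtain E and M :: real where E: "E \<in> sets lebesgue" "E \<subseteq> Q" "emeasure lebesgue E \<noteq> 0" "0 < M"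
      "\<And>x. x \<in> E \<Longrightarrow> op_norm (W x) \<le> M"
    using weight_bounded_on_subset[OF cube_props(1,2)[OF assms(2)]] by blast
  have fin: "emeasure lebesgue E < \<infinity>"
    using E(1,2) cube_props[OF assms(2)] by (meson emeasure_mono le_less_trans)
  define m where "m = measure lebesgue E"
  have m: "0 < m" "emeasure lebesgue E = ennreal m"
    using E(3) fin by (auto simp: m_def emeasure_eq_ennreal_measure zero_less_measure_iff less_top)
  \<comment> \<open>If the norm of \<open>W x\<close> exceeded \<open>M * K * t\<close> for an
    admissible \<open>t\<close>, the inner integrand would be at least \<open>K powr q y\<close>,
    hence at least \<open>K\<close>, almost everywhere on \<open>E\<close>. Its integral would be at
    least \<open>K * m\<close>, which this choice makes greater than 1.\<close>
  define K where "K = max 1 (2 / m)"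
  have K: "1 \<le> K" "1 < K * m"
    using m by (auto simp: K_def max_def field_simps)
  define N where "N x = Lp_var_norm q (\<lambda>y. ennreal (op_norm (W x ** matrix_inv (W y))) * indicator Q y)" for x
  have N: "ennreal (op_norm (W x) / (M * K)) \<le> N x" for x
    unfolding N_def Lp_var_norm_def
  proof (rule Inf_greatest, safe)
    fix t :: real
    assume t: "0 < t" "(\<integral>\<^sup>+ y. ennreal_powr (ennreal (op_norm (W x ** matrix_inv (W y))) * indicator Q y
        / ennreal t) (q y) \<partial>lebesgue) \<le> 1"
    have "op_norm (W x) \<le> M * K * t"
    proof (rule ccontr)
      assume big: "\<not> op_norm (W x) \<le> M * K * t"
      have "ennreal K * ennreal m = (\<integral>\<^sup>+ y. ennreal K * indicator E y \<partial>lebesgue)"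
        using E(1) m by (simp add: nn_integral_cmult_indicator)
      also have "\<dots> \<le> (\<integral>\<^sup>+ y. ennreal_powr (ennreal (op_norm (W x ** matrix_inv (W y))) * indicator Q y
        / ennreal t) (q y) \<partial>lebesgue)"
      proof (intro nn_integral_mono_AE, use weight_invertible conj.exponent_gt_1 in eventually_elim)
        case (elim y)
        show ?case
        proof (cases "y \<in> E")
          case True
          let ?u = "op_norm (W x ** matrix_inv (W y))"
          have "W x = (W x ** matrix_inv (W y)) ** W y"
            using elim(1) by (simp add: matrix_mul_assoc[symmetric] matrix_inv_mult)
          then have "op_norm (W x) \<le> ?u * op_norm (W y)"
            by (metis op_norm_matrix_mul)
          also have "\<dots> \<le> ?u * M"
            using E(5)[OF True] by (intro mult_left_mono op_norm_nonneg)
          finally have "M * (K * t) < M * ?u"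
            using big by (simp add: mult_ac)
          then have "K \<le> ?u / t"
            using E(4) t(1) by (simp add: field_simps)
          moreover have "K powr 1 \<le> K powr q y"
            using K elim(2) by (intro powr_mono) auto
          ultimately have "K \<le> (?u / t) powr q y"
            using K elim(2) powr_mono2[of "q y" K "?u / t"] by simp
          then show ?thesis
            using True E(2) t(1) op_norm_nonneg[of "W x ** matrix_inv (W y)"]
            by (auto simp: ennreal_powr_divide ennreal_leI)
        qed simp
      qed
      also have "\<dots> \<le> 1"
        by (rule t(2))
      finally show False
        using K m by (simp add: ennreal_mult[symmetric] del: ennreal_le_1)
         (simp add: ennreal_le_1)
    qed
    then show "ennreal (op_norm (W x) / (M * K)) \<le> ennreal t"
      using E(4) K by (intro ennreal_leI) (simp add: field_simps)
  qed
  have "ennreal (op_norm (W x)) * indicator Q x \<le> ennreal (M * K) * (N x * indicator Q x)" for x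
  proof -
    have "ennreal (op_norm (W x)) = ennreal (M * K) * ennreal (op_norm (W x) / (M * K))"
      using E(4) K op_norm_nonneg[of "W x"] by (simp add: ennreal_mult[symmetric])
    also have "\<dots> \<le> ennreal (M * K) * N x"
      by (intro mult_left_mono N) simp
    finally show ?thesis
      by (simp add: indicator_def)
  qed
  then have "Lp_var_norm p (\<lambda>x. ennreal (op_norm (W x)) * indicator Q x)
      \<le> Lp_var_norm p (\<lambda>x. ennreal (M * K) * (N x * indicator Q x))"
    by (intro Lp_var_norm_mono AE_I2)
  also have "\<dots> < \<infinity>"
    using Ap_finite_on_cube[OF assms] E(4) K
    by (intro Lp_var_norm_cmult_finite) (auto simp: N_def)
  finally show ?thesis .
qed

text \<open>Hoelder's inequality on \<open>Q\<close>, obtained by applying Young's inequality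
  pointwise to the factorisation of \<open>norm (f y)\<close> into \<open>a y\<close> and
  \<open>b y\<close>.\<close>

lemma local_L1_bound:
  assumes f: "f \<in> borel_measurable lebesgue" "LpW_norm p W f < ennreal M"
    and t: "Lp_var_norm q (\<lambda>y. ennreal (op_norm (matrix_inv (W y))) * indicator Q y) < ennreal t"
    and [measurable]: "Q \<in> sets lebesgue"
  shows "(\<integral>\<^sup>+ y. ennreal (norm (f y)) * indicator Q y \<partial>lebesgue) \<le> ennreal (2 * M * t)"
proof -
  note f(1) [measurable]
  define a where "a y = norm (W y *v f y)" for y
  \<comment> \<open>The quotient is dominated by the norm of the inverse matrix and is measurable by
    construction. Where \<open>a y = 0\<close> it takes the value 0, which is consistent because
    \<open>f y = 0\<close> there if \<open>W y\<close> is invertible.\<close>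
  define b where "b y = norm (f y) / a y * indicator Q y" for y
  have [measurable]: "a \<in> borel_measurable lebesgue" "b \<in> borel_measurable lebesgue"
    unfolding a_def b_def by measurable
  have ab0: "0 \<le> a y" "0 \<le> b y" for y
    by (auto simp: a_def b_def)
  have pos: "0 < M" "0 < t"
    using f(2) t by (metis ennreal_neg not_less not_less_zero)+
  have "AE y in lebesgue. b y \<le> op_norm (matrix_inv (W y)) * indicator Q y"
    using weight_invertible
  proof eventually_elim
    case (elim y)
    show ?case
    proof (cases "a y = 0")
      case False
      then have "norm (f y) / a y \<le> op_norm (matrix_inv (W y))"
        using norm_le_op_norm_inv[OF elim, of "f y"] ab0[of y]
        by (auto simp: a_def field_simps)
      then show ?thesis
        unfolding b_def by (intro mult_right_mono) auto
    qed (simp add: b_def op_norm_nonneg)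
  qed
  then have "Lp_var_norm q (\<lambda>y. ennreal (b y))
      \<le> Lp_var_norm q (\<lambda>y. ennreal (op_norm (matrix_inv (W y))) * indicator Q y)"
    by (intro conj.Lp_var_norm_mono, eventually_elim) (auto simp: indicator_def b_def intro: ennreal_leI)
  then have b: "modular q (\<lambda>y. b y / t) \<le> 1"
    using ab0 t by (intro conj.modular_le_1) auto
  have a: "modular p (\<lambda>y. a y / M) \<le> 1"
    using ab0 f(2) by (intro modular_le_1) (auto simp: a_def LpW_norm_def)
  have "(\<integral>\<^sup>+ y. ennreal (norm (f y)) * indicator Q y \<partial>lebesgue)
      \<le> (\<integral>\<^sup>+ y. ennreal (M * t) * (ennreal ((a y / M) powr p y) + ennreal ((b y / t) powr q y)) \<partial>lebesgue)"
  proof (intro nn_integral_mono_AE, use weight_invertible exponent_gt_1 conj.exponent_gt_1 in eventually_elim)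
    case (elim y)
    have "norm (f y) * indicator Q y = a y * b y"
    proof (cases "a y = 0")
      case True
      then show ?thesis
        using norm_le_op_norm_inv[OF elim(1), of "f y"] by (simp add: a_def)
    qed (simp add: b_def)
    also have "\<dots> = M * t * ((a y / M) * (b y / t))"
      using pos by simp
    also have "\<dots> \<le> M * t * ((a y / M) powr p y / p y + (b y / t) powr q y / q y)"
      using pos elim ab0
      by (intro mult_left_mono Youngs_inequality) (auto simp: conjugate_exponent_def field_simps)
    \<comment> \<open>Dropping the divisors \<open>p y\<close> and \<open>q y\<close>, both greater
      than 1, leaves two modulars bounded by 1; hence the factor 2.\<close>
    also have "\<dots> \<le> M * t * ((a y / M) powr p y + (b y / t) powr q y)"
      using pos elim by (intro mult_left_mono add_mono) (auto simp: divide_le_eq mult_le_cancel_left1)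
    finally have "ennreal (norm (f y) * indicator Q y)
        \<le> ennreal (M * t * ((a y / M) powr p y + (b y / t) powr q y))"
      by (rule ennreal_leI)
    then show ?case
      using pos by (simp add: ennreal_mult ennreal_indicator)
  qed
  also have "\<dots> = ennreal (M * t) * (modular p (\<lambda>y. a y / M) + modular q (\<lambda>y. b y / t))"
    unfolding modular_def by (simp add: nn_integral_cmult nn_integral_add)
  also have "\<dots> \<le> ennreal (M * t) * (1 + 1)"
    using a b by (intro mult_left_mono add_mono) auto
  also have "\<dots> = ennreal (M * t * 2)"
    using pos by (simp add: ennreal_mult one_add_one)
  finally show ?thesis
    by (simp add: mult_ac)
qed

end

subsection \<open>Averages over grid cells\<close>

text \<open>Tonelli's theorem for functions of \<open>x\<close> and \<open>x + y\<close> is applied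
  on the Borel product space, so Lebesgue measurable data are first replaced by Borel ones,
  coordinate by coordinate.\<close>

lemma borel_measurable_lebesgue_AE_eq_borel:
  fixes f :: "real^'n \<Rightarrow> 'b::euclidean_space"
  assumes "f \<in> borel_measurable lebesgue"
  obtains g where "g \<in> borel_measurable lborel" "AE x in lborel. f x = g x"
proof -
  have "\<forall>b\<in>Basis. \<exists>g\<in>borel_measurable lborel. AE x in lborel. f x \<bullet> b = g x"
    by (intro ballI completion_ex_borel_measurable_real borel_measurable_inner assms) simp
  then obtain g where g: "\<And>b. b \<in> Basis \<Longrightarrow> g b \<in> borel_measurable lborel"
      "\<And>b. b \<in> Basis \<Longrightarrow> AE x in lborel. f x \<bullet> b = g b x"
    by metis
  have "AE x in lborel. \<forall>b\<in>Basis. f x \<bullet> b = g b x"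
    using g(2) by (intro AE_finite_allI) auto
  then have "AE x in lborel. f x = (\<Sum>b\<in>Basis. g b x *\<^sub>R b)"
    by eventually_elim (subst euclidean_representation[symmetric], rule sum.cong, auto)
  moreover have "(\<lambda>x. \<Sum>b\<in>Basis. g b x *\<^sub>R b) \<in> borel_measurable lborel"
    using g(1) by (intro borel_measurable_sum borel_measurable_scaleR) auto
  ultimately show thesis
    by (rule that[rotated])
qed

lemma AE_lborel_translate:
  fixes y :: "'a::euclidean_space"
  assumes "AE x in lborel. P x"
  shows "AE x in lborel. P (y + x)"
proof -
  obtain N where N: "{x \<in> space lborel. \<not> P x} \<subseteq> N" "emeasure lborel N = 0" "N \<in> sets lborel"
    using assms by (rule AE_E)
  have "AE x in lborel. x \<notin> N"
    using N by (intro AE_not_in) auto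
  then have "AE x in distr lborel borel ((+) y). x \<notin> N"
    by (subst lborel_distr_plus)
  then have "AE x in lborel. y + x \<notin> N"
    using N(3) by (subst (asm) AE_distr_iff) auto
  then show ?thesis
    by eventually_elim (use N(1) in auto)
qed

lemma nn_integral_lborel_translate:
  fixes y :: "'a::euclidean_space"
  assumes [measurable]: "f \<in> borel_measurable borel"
  shows "(\<integral>\<^sup>+ x. f (y + x) \<partial>lborel) = (\<integral>\<^sup>+ x. f x \<partial>lborel)"
proof -
  have "(\<integral>\<^sup>+ x. f x \<partial>lborel) = (\<integral>\<^sup>+ x. f x \<partial>distr lborel borel ((+) y))"
    by (simp add: lborel_distr_plus)
  also have "\<dots> = (\<integral>\<^sup>+ x. f (y + x) \<partial>lborel)"
    by (intro nn_integral_distr) auto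
  finally show ?thesis ..
qed

section \<open>The grid, its closed cells and the means over them\<close>

text \<open>For \<open>0 < l\<close> the nonempty fibres of this map are the half-open grid cubes of
  side \<open>l\<close>, which partition the space; a grid step function is a function of
  \<open>corner l x\<close>.\<close>

definition corner :: "real \<Rightarrow> real^'n \<Rightarrow> real^'n" where
  "corner l x = (\<chi> i. l * real_of_int \<lfloor>x $ i / l\<rfloor>)"

text \<open>The closed cube belongs to \<open>cubes\<close> when \<open>0 < l\<close>; neighbouring
  cells share faces, so the partition is taken from \<open>corner\<close> instead.\<close>

definition cell :: "real \<Rightarrow> real^'n \<Rightarrow> (real^'n) set" where
  "cell l a = cbox a (a + vec l)"

definition cell_average :: "real \<Rightarrow> (real^'n \<Rightarrow> real^'m) \<Rightarrow> real^'n \<Rightarrow> real^'m" where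
  "cell_average l f a = (\<integral>z. f z \<partial>uniform_measure lebesgue (cell l a))"

lemma corner_measurable [measurable]: "corner l \<in> borel_measurable borel"
  by (intro borel_measurable_vec) (simp add: corner_def)

lemma in_cell_corner:
  assumes "0 < l"
  shows "x \<in> cell l (corner l x)"
proof -
  have "l * of_int \<lfloor>x $ i / l\<rfloor> \<le> x $ i \<and> x $ i \<le> l * of_int \<lfloor>x $ i / l\<rfloor> + l" for i
  proof -
    have "l * of_int \<lfloor>x $ i / l\<rfloor> \<le> l * (x $ i / l)" "l * (x $ i / l) \<le> l * (of_int \<lfloor>x $ i / l\<rfloor> + 1)"
      using assms by (intro mult_left_mono; linarith)+
    then show ?thesis
      using assms by (simp add: distrib_left)
  qed
  then show ?thesis
    by (simp add: cell_def corner_def mem_box_cart)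
qed

lemma cell_diff:
  assumes "x \<in> cell l a" "z \<in> cell l a"
  shows "z - x \<in> cbox (- vec l) (vec l)"
proof -
  have "- l \<le> z $ i - x $ i \<and> z $ i - x $ i \<le> l" for i
  proof -
    have "a $ i \<le> x $ i" "x $ i \<le> a $ i + l" "a $ i \<le> z $ i" "z $ i \<le> a $ i + l"
      using assms by (auto simp: cell_def mem_box_cart)
    then show ?thesis by linarith
  qed
  then show ?thesis
    by (simp add: mem_box_cart)
qed

lemma finite_corner_ball:
  assumes "0 < l"
  shows "finite (corner l ` ball (0 :: real^'n) R)"
proof -
  let ?N = "\<lceil>\<bar>R\<bar> / l\<rceil> + 1"
  let ?S = "(\<lambda>k. l * real_of_int k) ` {- ?N .. ?N}"
  have "corner l x \<in> (\<lambda>g. \<chi> i. g i) ` (UNIV \<rightarrow>\<^sub>E ?S)" if "x \<in> ball 0 R" for x :: "real^'n"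
  proof -
    have "\<lfloor>x $ i / l\<rfloor> \<in> {- ?N .. ?N}" for i
    proof -
      have "\<bar>x $ i\<bar> < \<bar>R\<bar>"
        using that component_le_norm_cart[of x i] by simp
      then have "\<bar>x $ i / l\<bar> \<le> \<bar>R\<bar> / l"
        using assms by (simp add: divide_right_mono)
      then have "x $ i / l \<le> \<bar>R\<bar> / l" "- (\<bar>R\<bar> / l) \<le> x $ i / l"
        by linarith+
      then show ?thesis
        unfolding atLeastAtMost_iff by linarith
    qed
    then show ?thesis
      by (intro image_eqI[of _ _ "\<lambda>i. l * real_of_int \<lfloor>x $ i / l\<rfloor>"]) (auto simp: corner_def)
  qed
  moreover have "finite ((\<lambda>g. \<chi> i. g i) ` (UNIV \<rightarrow>\<^sub>E ?S) :: (real^'n) set)"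
    by (intro finite_imageI finite_PiE) auto
  ultimately show ?thesis
    by (meson finite_subset image_subsetI)
qed

lemma vimage_corner_measurable:
  fixes A :: "(real^'n) set"
  assumes "finite A"
  shows "corner l -` A \<in> sets borel"
  by (intro measurable_sets_borel[OF corner_measurable] borel_closed finite_imp_closed assms)

text \<open>The map \<open>c\<close> is arbitrary, so measurability comes from rewriting the
  function as a finite sum of constants on the fibres of \<open>corner l\<close>.\<close>

lemma step_function_measurable:
  fixes c :: "real^'n \<Rightarrow> real^'m"
  assumes A: "finite A"
  shows "(\<lambda>x. indicator (corner l -` A) x *\<^sub>R c (corner l x)) \<in> borel_measurable lebesgue"
proof -
  have "(\<Sum>a\<in>A. indicator (corner l -` {a}) x *\<^sub>R c a)
      = (indicator (corner l -` A) x :: real) *\<^sub>R c (corner l x)" for x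
  proof (cases "corner l x \<in> A")
    case True
    have "(\<Sum>a\<in>A. indicator (corner l -` {a}) x *\<^sub>R c a)
        = (\<Sum>a\<in>{corner l x}. indicator (corner l -` {a}) x *\<^sub>R c a)"
      using A True by (intro sum.mono_neutral_right) (auto simp: indicator_def)
    then show ?thesis
      using True by simp
  qed (auto intro!: sum.neutral simp: indicator_def)
  moreover have meas: "corner l -` {a} \<in> sets lebesgue" for a :: "real^'n"
    using vimage_corner_measurable[of "{a}" l] by simp
  have "(\<lambda>x. \<Sum>a\<in>A. indicator (corner l -` {a}) x *\<^sub>R c a) \<in> borel_measurable lebesgue"
    using meas by (intro borel_measurable_sum borel_measurable_scaleR borel_measurable_indicator) auto
  ultimately show ?thesis
    by (simp add: fun_eq_iff)
qed

lemma cell_in_cubes: "0 < l \<Longrightarrow> cell l a \<in> cubes"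
  by (auto simp: cell_def cubes_def)

lemma sets_cell [measurable]: "cell l a \<in> sets borel"
  by (simp add: cell_def)

lemma emeasure_cell: "0 < l \<Longrightarrow> emeasure lebesgue (cell l (a :: real^'n)) = ennreal (l ^ CARD('n))"
  unfolding cell_def by (intro emeasure_cube) simp

lemma prob_space_cell:
  assumes "0 < l"
  shows "prob_space (uniform_measure lebesgue (cell l (a :: real^'n)))"
  using cube_props[OF cell_in_cubes[OF assms, of a]] by (intro prob_space_uniform_measure) auto

lemma nn_integral_cell:
  fixes a :: "real^'n"
  assumes "0 < l" "f \<in> borel_measurable lebesgue"
  shows "(\<integral>\<^sup>+ z. f z \<partial>uniform_measure lebesgue (cell l a))
    = (\<integral>\<^sup>+ z. f z * indicator (cell l a) z \<partial>lebesgue) / ennreal (l ^ CARD('n))"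
  unfolding emeasure_cell[OF assms(1), of a, symmetric] using assms(2)
  by (intro nn_integral_uniform_measure) auto

lemma norm_cell_average_le:
  fixes a :: "real^'n"
  assumes "0 < l" "f \<in> borel_measurable lebesgue" "0 \<le> C"
    and "(\<integral>\<^sup>+ z. ennreal (norm (f z)) * indicator (cell l a) z \<partial>lebesgue) \<le> ennreal C"
  shows "integrable (uniform_measure lebesgue (cell l a)) f"
    and "norm (cell_average l f a) \<le> C / l ^ CARD('n)"
proof -
  let ?U = "uniform_measure lebesgue (cell l a)"
  have "(\<integral>\<^sup>+ z. ennreal (norm (f z)) \<partial>?U) \<le> ennreal C / ennreal (l ^ CARD('n))"
    using assms by (subst nn_integral_cell) (auto intro: divide_right_mono_ennreal)
  also have "\<dots> = ennreal (C / l ^ CARD('n))"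
    using assms by (simp add: divide_ennreal)
  finally have le: "(\<integral>\<^sup>+ z. ennreal (norm (f z)) \<partial>?U) \<le> ennreal (C / l ^ CARD('n))" .
  then show int: "integrable ?U f"
    using assms(2) by (auto simp: integrable_iff_bounded intro: le_less_trans)
  have "ennreal (norm (cell_average l f a)) \<le> ennreal (\<integral>z. norm (f z) \<partial>?U)"
    unfolding cell_average_def by (intro ennreal_leI integral_norm_bound)
  also have "\<dots> = (\<integral>\<^sup>+ z. ennreal (norm (f z)) \<partial>?U)"
    using int by (intro nn_integral_eq_integral[symmetric]) auto
  also note le
  finally show "norm (cell_average l f a) \<le> C / l ^ CARD('n)"
    using assms by (subst (asm) ennreal_le_iff) auto
qed

text \<open>Matrix, vector and exponent are constants here. They will be \<open>W x\<close>,
  \<open>f x\<close> and \<open>p x\<close> at a single point \<open>x\<close>, so only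
  \<open>f\<close> is averaged and neither the weight nor the exponent has to be compared at
  different points.\<close>

lemma jensen_cell_average:
  fixes A :: "real^'m^'m" and f :: "real^'n \<Rightarrow> real^'m"
  assumes l: "0 < l" and f: "f \<in> borel_measurable lebesgue"
    and int: "integrable (uniform_measure lebesgue (cell l a)) f" and t: "0 < t" and s: "1 < s"
  shows "ennreal ((norm (A *v (v - cell_average l f a)) / t) powr s)
    \<le> (\<integral>\<^sup>+ z. ennreal ((norm (A *v (v - f z)) / t) powr s) * indicator (cell l a) z \<partial>lebesgue)
      / ennreal (l ^ CARD('n))"
proof -
  note f [measurable]
  interpret prob_space "uniform_measure lebesgue (cell l a)"
    by (rule prob_space_cell[OF l])
  let ?U = "uniform_measure lebesgue (cell l a)"
  have lin: "bounded_linear ((*v) A)"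
    by (rule matrix_vector_mul_bounded_linear)
  have int_diff: "integrable ?U (\<lambda>z. v - f z)"
    using int by simp
  have int_A: "integrable ?U (\<lambda>z. A *v (v - f z))"
    by (rule integrable_bounded_linear[OF lin int_diff])
  have "v - cell_average l f a = (\<integral>z. v - f z \<partial>?U)"
    using int prob_space by (simp add: cell_average_def)
  then have "A *v (v - cell_average l f a) = (\<integral>z. A *v (v - f z) \<partial>?U)"
    using integral_bounded_linear[OF lin int_diff] by simp
  then have "norm (A *v (v - cell_average l f a)) / t \<le> (\<integral>z. norm (A *v (v - f z)) / t \<partial>?U)"
    using t by (simp add: divide_right_mono integral_norm_bound)
  then have "ennreal ((norm (A *v (v - cell_average l f a)) / t) powr s)
      \<le> ennreal ((\<integral>z. norm (A *v (v - f z)) / t \<partial>?U) powr s)"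
    using t s by (intro ennreal_leI powr_mono2) auto
  also have "\<dots> \<le> (\<integral>\<^sup>+ z. ennreal ((norm (A *v (v - f z)) / t) powr s) \<partial>?U)"
    using int_A t s by (intro powr_jensen) auto
  also have "\<dots> = (\<integral>\<^sup>+ z. ennreal ((norm (A *v (v - f z)) / t) powr s) * indicator (cell l a) z \<partial>lebesgue)
      / ennreal (l ^ CARD('n))"
    using l by (intro nn_integral_cell) measurable
  finally show ?thesis .
qed

section \<open>Approximation by cell means\<close>

context weighted_exponent begin

text \<open>After Jensen at \<open>x\<close>, the cell of \<open>x\<close> is enlarged to the
  translate by \<open>x\<close> of the cube with coordinates in \<open>[-l, l]\<close>, so that the
  range of \<open>y = z - x\<close> no longer depends on \<open>x\<close>. Tonelli then leaves
  modulars of translation differences, each at most 1. The constant is the ratio of the volumes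
  \<open>(2 * l) ^ CARD('n)\<close> and \<open>l ^ CARD('n)\<close>.\<close>

lemma LpW_norm_cell_average_le:
  assumes l: "0 < l" and f [measurable]: "f \<in> borel_measurable lebesgue"
    and int: "\<And>a. a \<in> A \<Longrightarrow> integrable (uniform_measure lebesgue (cell l a)) f"
    and A: "finite A"
    and close: "\<And>y. y \<in> cbox (- vec l) (vec l) \<Longrightarrow>
      LpW_norm p W (\<lambda>x. translate y f x - f x) < ennreal t"
  shows "LpW_norm p W (\<lambda>x. indicator (corner l -` A) x *\<^sub>R (f x - cell_average l f (corner l x)))
    \<le> ennreal (2 ^ CARD('n) * t)"
proof -
  have t: "0 < t"
    using close[of 0] l by (cases "0 < t") (auto simp: mem_box_cart ennreal_neg not_less)
  obtain p0 where p0 [measurable]: "p0 \<in> borel_measurable lborel" and p_eq: "AE x in lborel. p x = p0 x"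
    using completion_ex_borel_measurable_real[OF exponent_measurable] by blast
  obtain f0 where f0 [measurable]: "f0 \<in> borel_measurable lborel" and f_eq: "AE x in lborel. f x = f0 x"
    using borel_measurable_lebesgue_AE_eq_borel[OF f] by blast
  obtain W0 where W0 [measurable]: "W0 \<in> borel_measurable lborel" and W_eq: "AE x in lborel. W x = W0 x"
    using borel_measurable_lebesgue_AE_eq_borel[OF weight_measurable] by blast
  define H where "H x z = ennreal ((norm (W0 x *v (f0 x - f0 z)) / t) powr p0 x)" for x z
  have H [measurable]: "case_prod H \<in> borel_measurable (borel \<Otimes>\<^sub>M borel)"
  proof -
    have [measurable]: "p0 \<in> borel_measurable borel" "f0 \<in> borel_measurable borel" "W0 \<in> borel_measurable borel"
      using p0 f0 W0 by simp_all
    show ?thesis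
      unfolding H_def by measurable
  qed
  have H_x [measurable]: "H x \<in> borel_measurable borel" for x
    using measurable_Pair2[OF H, of x] by simp
  let ?D = "cbox (- vec l) (vec l) :: (real^'n) set"
  let ?L = "ennreal (l ^ CARD('n))"
  define u where "u x = indicator (corner l -` A) x *\<^sub>R (f x - cell_average l f (corner l x))" for x
  have ptwise: "AE x in lborel. ennreal ((norm (W x *v u x) / t) powr p x)
      \<le> (\<integral>\<^sup>+ y. indicator ?D y * H x (x + y) \<partial>lborel) / ?L"
    using exponent_gt_1[unfolded AE_completion_iff] p_eq f_eq W_eq
  proof eventually_elim
    case (elim x)
    show ?case
    proof (cases "corner l x \<in> A")
      case True
      let ?Q = "cell l (corner l x)"
      have "ennreal ((norm (W x *v u x) / t) powr p x)
        \<le> (\<integral>\<^sup>+ z. ennreal ((norm (W x *v (f x - f z)) / t) powr p x) * indicator ?Q z \<partial>lebesgue) / ?L"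
        using True jensen_cell_average[OF l f int[OF True] t, of "p x" "W x" "f x"] elim(1)
        by (simp add: u_def)
      also have "(\<integral>\<^sup>+ z. ennreal ((norm (W x *v (f x - f z)) / t) powr p x) * indicator ?Q z \<partial>lebesgue)
          = (\<integral>\<^sup>+ z. H x z * indicator ?Q z \<partial>lborel)"
        unfolding nn_integral_completion
        by (intro nn_integral_cong_AE, use f_eq in eventually_elim) (simp add: H_def elim)
      also have "\<dots> \<le> (\<integral>\<^sup>+ z. indicator ?D (z - x) * H x z \<partial>lborel)"
        using cell_diff[OF in_cell_corner[OF l, of x]]
        by (intro nn_integral_mono) (auto simp: indicator_def)
      also have "\<dots> = (\<integral>\<^sup>+ y. indicator ?D (x + y - x) * H x (x + y) \<partial>lborel)"
        by (rule nn_integral_lborel_translate[symmetric]) measurable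
      finally show ?thesis
        by (simp add: divide_right_mono_ennreal)
    qed (simp add: u_def)
  qed
  have inner: "(\<integral>\<^sup>+ x. H x (x + y) \<partial>lborel) \<le> 1" if y: "y \<in> ?D" for y
  proof -
    \<comment> \<open>Comparing \<open>f x\<close> with \<open>f (x + y)\<close> is translation by
      \<open>- y\<close>, so the symmetry of the cube is used.\<close>
    have "- y \<in> ?D"
    proof -
      have "- l \<le> y $ i \<and> y $ i \<le> l" for i
        using y by (simp add: mem_box_cart)
      then show ?thesis
        by (simp add: mem_box_cart minus_le_iff[of l] neg_le_iff_le[of _ l])
    qed
    then have "modular p (\<lambda>x. norm (W x *v (translate (- y) f x - f x)) / t) \<le> 1"
      using close[of "- y"] by (intro modular_le_1) (auto simp: LpW_norm_def)
    also have "modular p (\<lambda>x. norm (W x *v (translate (- y) f x - f x)) / t)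
        = (\<integral>\<^sup>+ x. H x (x + y) \<partial>lborel)"
      unfolding modular_def nn_integral_completion
    \<comment> \<open>The representative of \<open>f\<close> must agree with \<open>f\<close> at
      \<open>x\<close> and at \<open>y + x\<close>; the second exceptional set is a translated null
      set.\<close>
    proof (intro nn_integral_cong_AE, use p_eq f_eq W_eq AE_lborel_translate[OF f_eq, of y] in eventually_elim)
      case (elim x)
      have "norm (W0 x *v (f0 (y + x) - f0 x)) = norm (W0 x *v (f0 x - f0 (y + x)))"
        by (metis matrix_vector_mult_diff_distrib norm_minus_commute)
      then show ?case
        using elim by (simp add: translate_def H_def add.commute)
    qed
    finally show ?thesis .
  qed
  have "modular p (\<lambda>x. norm (W x *v u x) / t)
      \<le> (\<integral>\<^sup>+ x. (\<integral>\<^sup>+ y. indicator ?D y * H x (x + y) \<partial>lborel) / ?L \<partial>lborel)"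
    unfolding modular_def nn_integral_completion by (intro nn_integral_mono_AE ptwise)
  also have "\<dots> = (\<integral>\<^sup>+ x. (\<integral>\<^sup>+ y. indicator ?D y * H x (x + y) \<partial>lborel) \<partial>lborel) / ?L"
    by (intro nn_integral_divide) measurable
  also have "(\<integral>\<^sup>+ x. (\<integral>\<^sup>+ y. indicator ?D y * H x (x + y) \<partial>lborel) \<partial>lborel)
      = (\<integral>\<^sup>+ y. (\<integral>\<^sup>+ x. indicator ?D y * H x (x + y) \<partial>lborel) \<partial>lborel)"
    by (intro lborel_pair.Fubini') measurable
  also have "\<dots> = (\<integral>\<^sup>+ y. indicator ?D y * (\<integral>\<^sup>+ x. H x (x + y) \<partial>lborel) \<partial>lborel)"
    by (intro nn_integral_cong nn_integral_cmult) measurable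
  also have "\<dots> \<le> (\<integral>\<^sup>+ y. indicator ?D y \<partial>lborel)"
    using inner by (intro nn_integral_mono) (auto simp: indicator_def)
  also have "\<dots> = ennreal ((2 * l) ^ CARD('n))"
  proof -
    have "- vec l + vec (2 * l) = (vec l :: real^'n)"
      by (simp add: vec_eq_iff)
    then show ?thesis
      using emeasure_cube[of "2 * l" "- vec l :: real^'n"] l by simp
  qed
  finally have "modular p (\<lambda>x. norm (W x *v u x) / t) \<le> ennreal ((2 * l) ^ CARD('n)) / ?L"
    by (simp add: divide_right_mono_ennreal)
  also have "\<dots> = ennreal (2 ^ CARD('n))"
    using l by (simp add: divide_ennreal power_mult_distrib)
  finally have le: "modular p (\<lambda>x. norm (W x *v u x) / t) \<le> ennreal (2 ^ CARD('n))" .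
  have [measurable]: "u \<in> borel_measurable lebesgue"
  proof -
    have "u = (\<lambda>x. indicator (corner l -` A) x *\<^sub>R f x
        - indicator (corner l -` A) x *\<^sub>R cell_average l f (corner l x))"
      by (simp add: u_def fun_eq_iff scaleR_diff_right)
    moreover have "corner l -` A \<in> sets lebesgue"
      using vimage_corner_measurable[OF A, of l] by simp
    then have "(\<lambda>x. indicator (corner l -` A) x *\<^sub>R f x
        - indicator (corner l -` A) x *\<^sub>R cell_average l f (corner l x)) \<in> borel_measurable lebesgue"
      using f by (intro borel_measurable_diff borel_measurable_scaleR borel_measurable_indicator
          step_function_measurable[OF A])
    ultimately show ?thesis
      by simp
  qed
  \<comment> \<open>By \<open>modular_scale\<close>, a modular bound of at least 1 becomes a factor
    in the norm.\<close>
  have "modular p (\<lambda>x. norm (W x *v u x) / t / 2 ^ CARD('n)) \<le> 1"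
    using le t by (intro modular_scale) auto
  then have "LpW_norm p W u \<le> ennreal (2 ^ CARD('n) * t)"
    unfolding LpW_norm_def using t by (intro Lp_var_norm_le) (auto simp: mult.commute)
  then show ?thesis
    by (simp add: u_def[abs_def])
qed

end

subsection \<open>Total boundedness\<close>

lemma ennreal_less_realE:
  assumes "x < (\<infinity> :: ennreal)"
  obtains r where "0 < r" "x < ennreal r"
proof -
  obtain s where s: "0 \<le> s" "x = ennreal s"
    using assms by (cases x) auto
  show thesis
    using s by (intro that[of "s + 1"]) (auto simp: ennreal_less_iff)
qed

lemma cbox_vec_subset_ball:
  assumes "0 < r"
  obtains l where "0 < l" "cbox (- vec l) (vec l) \<subseteq> ball (0 :: real^'n) r"
proof
  \<comment> \<open>With this bound on every coordinate the sum of their absolute values is at most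
    \<open>r / 2\<close>, which dominates the Euclidean norm and stays inside the open ball.\<close>
  let ?l = "r / (2 * CARD('n))"
  show "0 < ?l"
    using assms by simp
  show "cbox (- vec ?l) (vec ?l) \<subseteq> ball (0 :: real^'n) r"
  proof
    fix y :: "real^'n" assume "y \<in> cbox (- vec ?l) (vec ?l)"
    then have "\<bar>y $ i\<bar> \<le> ?l" for i
      by (simp add: mem_box_cart abs_le_iff minus_le_iff)
    then have "(\<Sum>i\<in>UNIV. \<bar>y $ i\<bar>) \<le> (\<Sum>i\<in>(UNIV :: 'n set). ?l)"
      by (intro sum_mono)
    then have "norm y \<le> r / 2"
      using norm_le_l1_cart[of y] by simp
    then show "y \<in> ball 0 r"
      using assms by simp
  qed
qed

lemma bounded_subset_cube:
  fixes S :: "(real^'n) set"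
  assumes "bounded S"
  obtains Q where "Q \<in> cubes" "S \<subseteq> Q"
proof -
  obtain N where N: "0 < N" "\<And>x. x \<in> S \<Longrightarrow> norm x \<le> N"
    using assms by (auto simp: bounded_pos)
  have "x \<in> cbox (vec (- N)) (vec (- N) + vec (2 * N))" if "x \<in> S" for x
  proof -
    have "\<bar>x $ i\<bar> \<le> N" for i
      using N(2)[OF that] component_le_norm_cart[of x i] by simp
    then show ?thesis
      by (auto simp: mem_box_cart abs_le_iff minus_le_iff)
  qed
  moreover have "cbox (vec (- N)) (vec (- N) + vec (2 * N)) \<in> cubes"
    using N(1) unfolding cubes_def by (intro CollectI exI[of _ "vec (- N)"] exI[of _ "2 * N"]) auto
  ultimately show thesis
    by (intro that) auto
qed

text \<open>All values lie in one compact ball, so each may be rounded to a finite net of radius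
  \<open>d / 2\<close>; equal roundings then mean values closer than \<open>d\<close>.\<close>

lemma finite_net_map:
  fixes c :: "'f \<Rightarrow> 'a \<Rightarrow> 'b::euclidean_space"
  assumes "finite A" "0 < d" and bound: "\<And>f a. f \<in> F \<Longrightarrow> a \<in> A \<Longrightarrow> norm (c f a) \<le> C"
  obtains \<Phi> :: "'f \<Rightarrow> 'a \<Rightarrow> 'b" where "finite (\<Phi> ` F)"
    "\<And>f g a. f \<in> F \<Longrightarrow> g \<in> F \<Longrightarrow> \<Phi> f = \<Phi> g \<Longrightarrow> a \<in> A \<Longrightarrow> dist (c f a) (c g a) < d"
proof -
  obtain T where T: "finite T" "cball (0 :: 'b) C \<subseteq> (\<Union>t\<in>T. ball t (d / 2))"
    using compact_cball[of "0 :: 'b" C] \<open>0 < d\<close> unfolding compact_eq_totally_bounded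
    by (meson half_gt_zero)
  \<comment> \<open>Restriction to \<open>A\<close> fixes the values elsewhere, which puts the image
    into the finite set of extensional functions from \<open>A\<close> to the net.\<close>
  define \<Phi> where "\<Phi> f = (\<lambda>a\<in>A. SOME t. t \<in> T \<and> c f a \<in> ball t (d / 2))" for f
  have \<Phi>: "\<Phi> f a \<in> T" "dist (\<Phi> f a) (c f a) < d / 2" if "f \<in> F" "a \<in> A" for f a
  proof -
    have "\<exists>t. t \<in> T \<and> c f a \<in> ball t (d / 2)"
      using bound[OF that] T(2) by (auto simp: subset_iff)
    then have "(SOME t. t \<in> T \<and> c f a \<in> ball t (d / 2)) \<in> T
        \<and> c f a \<in> ball (SOME t. t \<in> T \<and> c f a \<in> ball t (d / 2)) (d / 2)"
      by (rule someI_ex)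
    then show "\<Phi> f a \<in> T" "dist (\<Phi> f a) (c f a) < d / 2"
      using that(2) by (auto simp: \<Phi>_def)
  qed
  show thesis
  proof (rule that)
    have "\<Phi> ` F \<subseteq> A \<rightarrow>\<^sub>E T"
      using \<Phi>(1) by (auto simp: \<Phi>_def)
    then show "finite (\<Phi> ` F)"
      using finite_PiE[of A "\<lambda>_. T"] assms(1) T(1) by (auto intro: finite_subset)
    show "dist (c f a) (c g a) < d" if "f \<in> F" "g \<in> F" "\<Phi> f = \<Phi> g" "a \<in> A" for f g a
      using \<Phi>(2)[OF that(1,4)] \<Phi>(2)[OF that(2,4)] that(3)
      by (metis dist_commute dist_triangle_half_r)
  qed
qed

context weighted_exponent begin

lemma LpW_norm_mono:
  assumes "\<And>x. norm (W x *v f x) \<le> norm (W x *v g x)"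
  shows "LpW_norm p W f \<le> LpW_norm p W g"
  unfolding LpW_norm_def by (intro Lp_var_norm_mono AE_I2 ennreal_leI assms)

lemma LpW_norm_step_le:
  assumes K: "Lp_var_norm p (\<lambda>x. ennreal (op_norm (W x)) * indicator Q x) < ennreal K"
    and d: "0 < d" and u: "\<And>x. norm (u x) \<le> d * indicator Q x"
  shows "LpW_norm p W u \<le> ennreal (d * K)"
proof -
  let ?h = "\<lambda>x. op_norm (W x) * indicator Q x"
  have "0 < K"
    using K by (metis ennreal_neg not_less not_less_zero)
  have h0: "0 \<le> ?h x" for x
    by (simp add: op_norm_nonneg)
  have "ennreal (op_norm (W x)) * indicator Q x = ennreal (?h x)" for x
    by (simp add: indicator_def)
  then have "Lp_var_norm p (\<lambda>x. ennreal (?h x)) < ennreal K"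
    using K by simp
  with h0 have mod: "modular p (\<lambda>x. ?h x / K) \<le> 1"
    by (rule modular_le_1)
  have "modular p (\<lambda>x. norm (W x *v u x) / (d * K)) \<le> modular p (\<lambda>x. ?h x / K)"
  proof (intro modular_mono AE_I2)
    fix x
    have "norm (W x *v u x) \<le> op_norm (W x) * norm (u x)"
      by (rule norm_matrix_vector_mult_le)
    also have "\<dots> \<le> op_norm (W x) * (d * indicator Q x)"
      by (intro mult_left_mono u op_norm_nonneg)
    finally show "norm (W x *v u x) / (d * K) \<le> ?h x / K"
      using d \<open>0 < K\<close> by (simp add: field_simps)
  qed (use d \<open>0 < K\<close> in auto)
  with mod have "modular p (\<lambda>x. norm (W x *v u x) / (d * K)) \<le> 1"
    by simp
  then show ?thesis
    unfolding LpW_norm_def using d \<open>0 < K\<close> by (intro Lp_var_norm_le) auto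
qed

lemma LpW_norm_add5_le:
  assumes [measurable]: "u1 \<in> borel_measurable lebesgue" "u2 \<in> borel_measurable lebesgue"
    "u3 \<in> borel_measurable lebesgue" "u4 \<in> borel_measurable lebesgue" "u5 \<in> borel_measurable lebesgue"
  shows "LpW_norm p W (\<lambda>x. (u1 x - u2 x) + u3 x + (u4 x - u5 x))
    \<le> LpW_norm p W u1 + LpW_norm p W u2 + LpW_norm p W u3 + (LpW_norm p W u4 + LpW_norm p W u5)"
proof -
  have "LpW_norm p W (\<lambda>x. (u1 x - u2 x) + u3 x + (u4 x - u5 x))
      \<le> LpW_norm p W (\<lambda>x. (u1 x - u2 x) + u3 x) + LpW_norm p W (\<lambda>x. u4 x - u5 x)"
    by (intro LpW_norm_triangle) auto
  also have "\<dots> \<le> (LpW_norm p W (\<lambda>x. u1 x - u2 x) + LpW_norm p W u3) + LpW_norm p W (\<lambda>x. u4 x - u5 x)"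
    by (intro add_mono LpW_norm_triangle) auto
  also have "\<dots> \<le> LpW_norm p W u1 + LpW_norm p W u2 + LpW_norm p W u3 + (LpW_norm p W u4 + LpW_norm p W u5)"
    by (intro add_mono LpW_norm_diff_le) auto
  finally show ?thesis .
qed

text \<open>The fibres of \<open>\<Phi>\<close> are the pieces of small diameter. Choosing one
  member of each later yields a finite net with centres in \<open>F\<close> itself.\<close>

lemma finite_pieces:
  assumes Ap: "Ap_characteristic p W < \<infinity>" and F: "F \<subseteq> LpW_fun p W"
    and bounded: "(SUP f\<in>F. LpW_norm p W f) < \<infinity>"
    and vanishing: "((\<lambda>R::real. SUP f\<in>F. LpW_norm p W (\<lambda>x. indicator (- ball 0 R) x *\<^sub>R f x))
           \<longlongrightarrow> 0) at_top"
    and equicontinuous: "((\<lambda>r::real. SUP f\<in>F. SUP y\<in>ball 0 r.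
           LpW_norm p W (\<lambda>x. translate y f x - f x)) \<longlongrightarrow> 0) (at_right 0)"
    and e: "0 < (e :: real)"
  obtains \<Phi> :: "(real^'n \<Rightarrow> real^'m) \<Rightarrow> real^'n \<Rightarrow> real^'m" where "finite (\<Phi> ` F)"
    "\<And>f g. f \<in> F \<Longrightarrow> g \<in> F \<Longrightarrow> \<Phi> f = \<Phi> g \<Longrightarrow> LpW_norm p W (\<lambda>x. f x - g x) < ennreal e"
proof -
  have meas [measurable]: "f \<in> borel_measurable lebesgue" if "f \<in> F" for f
    using that F by (auto simp: LpW_fun_def)
  obtain M where M: "\<And>f. f \<in> F \<Longrightarrow> LpW_norm p W f < ennreal M"
  proof -
    obtain s where s: "(SUP f\<in>F. LpW_norm p W f) < ennreal s"
      using ennreal_less_realE[OF bounded] by blast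
    have "LpW_norm p W f < ennreal s" if "f \<in> F" for f
      using SUP_upper[OF that] s by (rule le_less_trans)
    then show thesis by (rule that)
  qed
  obtain R where R: "\<And>f. f \<in> F \<Longrightarrow> LpW_norm p W (\<lambda>x. indicator (- ball 0 R) x *\<^sub>R f x) < ennreal (e / 8)"
  proof -
    have "eventually (\<lambda>R. (SUP f\<in>F. LpW_norm p W (\<lambda>x. indicator (- ball 0 R) x *\<^sub>R f x)) < ennreal (e / 8)) at_top"
      using e by (intro order_tendstoD(2)[OF vanishing]) simp
    then obtain R where "(SUP f\<in>F. LpW_norm p W (\<lambda>x. indicator (- ball 0 R) x *\<^sub>R f x)) < ennreal (e / 8)"
      using eventually_happens'[OF trivial_limit_at_top_linorder] by blast
    then have "LpW_norm p W (\<lambda>x. indicator (- ball 0 R) x *\<^sub>R f x) < ennreal (e / 8)" if "f \<in> F" for f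
      by (rule le_less_trans[OF SUP_upper[OF that]])
    then show thesis
      by (rule that)
  qed
  \<comment> \<open>Chosen to absorb the constant of
    \<open>LpW_norm_cell_average_le\<close>.\<close>
  define t where "t = e / (8 * 2 ^ CARD('n))"
  have t: "0 < t" "2 ^ CARD('n) * t = e / 8"
    using e by (auto simp: t_def)
  obtain l where l: "0 < l"
    and close: "\<And>f y. f \<in> F \<Longrightarrow> y \<in> cbox (- vec l) (vec l) \<Longrightarrow>
      LpW_norm p W (\<lambda>x. translate y f x - f x) < ennreal t"
  proof -
    have "eventually (\<lambda>r. (SUP f\<in>F. SUP y\<in>ball 0 r. LpW_norm p W (\<lambda>x. translate y f x - f x)) < ennreal t \<and> 0 < r)
        (at_right 0)"
      using t by (intro eventually_conj order_tendstoD(2)[OF equicontinuous] eventually_at_right_less) simp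
    then obtain r where r: "0 < r"
        "(SUP f\<in>F. SUP y\<in>ball 0 r. LpW_norm p W (\<lambda>x. translate y f x - f x)) < ennreal t"
      using eventually_happens'[OF trivial_limit_at_right_real] by blast
    obtain l where l: "0 < l" "cbox (- vec l) (vec l) \<subseteq> ball (0 :: real^'n) r"
      using cbox_vec_subset_ball[OF r(1)] by blast
    have "LpW_norm p W (\<lambda>x. translate y f x - f x) < ennreal t"
      if "f \<in> F" "y \<in> cbox (- vec l) (vec l)" for f y
    proof -
      have "LpW_norm p W (\<lambda>x. translate y f x - f x)
          \<le> (SUP y\<in>ball 0 r. LpW_norm p W (\<lambda>x. translate y f x - f x))"
        using that l(2) by (intro SUP_upper) auto
      also have "\<dots> \<le> (SUP f\<in>F. SUP y\<in>ball 0 r. LpW_norm p W (\<lambda>x. translate y f x - f x))"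
        using that(1) by (rule SUP_upper)
      finally show ?thesis
        using r(2) by (rule le_less_trans)
    qed
    with l(1) show thesis by (rule that)
  qed
  define A where "A = corner l ` ball (0 :: real^'n) R"
  have A [simp]: "finite A"
    unfolding A_def using l by (rule finite_corner_ball)
  \<comment> \<open>The union of all half-open grid cubes meeting the ball: it contains the ball, so
    the tail estimate applies outside it, and it is bounded because \<open>A\<close> is
    finite.\<close>
  define B where "B = corner l -` A"
  have [measurable]: "B \<in> sets lebesgue"
    using vimage_corner_measurable[OF A, of l] by (simp add: B_def)
  have ball_B: "ball 0 R \<subseteq> B"
    by (auto simp: A_def B_def)
  have "bounded (\<Union>a\<in>A. cell l a)"
    by (intro bounded_UN) (auto simp: cell_def)
  then obtain Q where Q: "Q \<in> cubes" "(\<Union>a\<in>A. cell l a) \<subseteq> Q"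
    by (rule bounded_subset_cube)
  have B_Q: "B \<subseteq> Q"
    using Q(2) in_cell_corner[OF l] by (auto simp: B_def)
  obtain K where K: "Lp_var_norm p (\<lambda>x. ennreal (op_norm (W x)) * indicator Q x) < ennreal K" "0 < K"
    using ennreal_less_realE[OF weight_local[OF Ap Q(1)]] by blast
  obtain s where s: "Lp_var_norm q (\<lambda>y. ennreal (op_norm (matrix_inv (W y))) * indicator Q y) < ennreal s"
    using ennreal_less_realE[OF inverse_weight_local[OF Ap Q(1)]] by blast
  \<comment> \<open>The maximum gives a nonnegative constant even if \<open>F\<close> is empty, when
    the sign of \<open>M\<close> is unknown.\<close>
  define C where "C = max 0 (2 * M * s)"
  have cell_bound: "(\<integral>\<^sup>+ z. ennreal (norm (f z)) * indicator (cell l a) z \<partial>lebesgue) \<le> ennreal C"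
    if "f \<in> F" "a \<in> A" for f a
  proof -
    have "(\<integral>\<^sup>+ z. ennreal (norm (f z)) * indicator (cell l a) z \<partial>lebesgue)
        \<le> (\<integral>\<^sup>+ z. ennreal (norm (f z)) * indicator Q z \<partial>lebesgue)"
      using Q(2) that(2) by (intro nn_integral_mono) (auto simp: indicator_def)
    also have "\<dots> \<le> ennreal (2 * M * s)"
      using that(1) cube_props(1)[OF Q(1)] by (intro local_L1_bound meas M s)
    also have "\<dots> \<le> ennreal C"
      by (simp add: C_def ennreal_leI)
    finally show ?thesis .
  qed
  have C: "0 \<le> C" by (simp add: C_def)
  \<comment> \<open>Means closer than \<open>d\<close> give step functions whose difference has norm
    at most \<open>d * K = e / 8\<close>.\<close>
  define d where "d = e / (8 * K)"
  have d: "0 < d" "d * K = e / 8"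
    using e K(2) by (auto simp: d_def)
  obtain \<Phi> :: "(real^'n \<Rightarrow> real^'m) \<Rightarrow> real^'n \<Rightarrow> real^'m" where \<Phi>: "finite (\<Phi> ` F)"
    "\<And>f g a. f \<in> F \<Longrightarrow> g \<in> F \<Longrightarrow> \<Phi> f = \<Phi> g \<Longrightarrow> a \<in> A \<Longrightarrow>
      dist (cell_average l f a) (cell_average l g a) < d"
    using finite_net_map[OF A d(1), of F "cell_average l"]
      norm_cell_average_le(2)[OF l meas C cell_bound] by blast
  have near: "LpW_norm p W (\<lambda>x. indicator B x *\<^sub>R (f x - cell_average l f (corner l x))) \<le> ennreal (e / 8)"
    if "f \<in> F" for f
    unfolding t(2)[symmetric] B_def
    using that norm_cell_average_le(1)[OF l meas C cell_bound] close
    by (intro LpW_norm_cell_average_le l meas A) auto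
  have far: "LpW_norm p W (\<lambda>x. indicator (- B) x *\<^sub>R f x) \<le> ennreal (e / 8)" if "f \<in> F" for f
  proof -
    have "LpW_norm p W (\<lambda>x. indicator (- B) x *\<^sub>R f x)
        \<le> LpW_norm p W (\<lambda>x. indicator (- ball 0 R) x *\<^sub>R f x)"
      using ball_B by (intro LpW_norm_mono) (auto simp: indicator_def)
    also have "\<dots> \<le> ennreal (e / 8)"
      using R[OF that] by simp
    finally show ?thesis .
  qed
  show thesis
  proof (rule that[OF \<Phi>(1)])
    fix f g assume fg: "f \<in> F" "g \<in> F" "\<Phi> f = \<Phi> g"
    note [measurable] = meas[OF fg(1)] meas[OF fg(2)]
    let ?P = "\<lambda>f x. indicator B x *\<^sub>R cell_average l f (corner l x)"
    let ?u = "\<lambda>f x. indicator B x *\<^sub>R (f x - cell_average l f (corner l x))"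
    have P [measurable]: "?P f \<in> borel_measurable lebesgue" "?P g \<in> borel_measurable lebesgue"
      unfolding B_def by (rule step_function_measurable[OF A])+
    have u_eq: "?u f = (\<lambda>x. indicator B x *\<^sub>R f x - ?P f x)" for f
      by (simp add: scaleR_diff_right)
    have u [measurable]: "?u f \<in> borel_measurable lebesgue" "?u g \<in> borel_measurable lebesgue"
      unfolding u_eq by measurable
    have step: "LpW_norm p W (\<lambda>x. ?P f x - ?P g x) \<le> ennreal (e / 8)"
      unfolding d(2)[symmetric]
    proof (rule LpW_norm_step_le[OF K(1) d(1)])
      fix x
      show "norm (?P f x - ?P g x) \<le> d * indicator Q x"
      proof (cases "x \<in> B")
        case True
        then show ?thesis
          using \<Phi>(2)[OF fg, of "corner l x"] B_Q by (auto simp: B_def dist_norm)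
      qed (simp add: d(1) less_imp_le)
    qed
    \<comment> \<open>On \<open>B\<close> the means are inserted and removed again; outside
      \<open>B\<close> both functions are small. This makes five terms of size at most
      \<open>e / 8\<close>.\<close>
    have "LpW_norm p W (\<lambda>x. f x - g x) = LpW_norm p W (\<lambda>x. (?u f x - ?u g x) + (?P f x - ?P g x)
        + (indicator (- B) x *\<^sub>R f x - indicator (- B) x *\<^sub>R g x))"
      by (intro arg_cong[where f = "LpW_norm p W"]) (auto simp: fun_eq_iff indicator_def)
    also have "\<dots> \<le> LpW_norm p W (?u f) + LpW_norm p W (?u g) + LpW_norm p W (\<lambda>x. ?P f x - ?P g x)
        + (LpW_norm p W (\<lambda>x. indicator (- B) x *\<^sub>R f x) + LpW_norm p W (\<lambda>x. indicator (- B) x *\<^sub>R g x))"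
      by (rule LpW_norm_add5_le) measurable
    also have "\<dots> \<le> ennreal (e / 8) + ennreal (e / 8) + ennreal (e / 8) + (ennreal (e / 8) + ennreal (e / 8))"
      using fg by (intro add_mono near far step)
    also have "\<dots> = ennreal (5 * e / 8)"
      using e by (simp flip: ennreal_plus)
    also have "\<dots> < ennreal e"
      using e by (simp add: ennreal_less_iff)
    finally show "LpW_norm p W (\<lambda>x. f x - g x) < ennreal e" .
  qed
qed

end

theorem theorem3p1:
  fixes p :: "real^'n \<Rightarrow> real"
    and W :: "real^'n \<Rightarrow> real^'m^'m"
    and \<F> :: "(real^'n \<Rightarrow> real^'m) set"
  assumes "p \<in> exponents"
    and "W \<in> matrix_Ap p"
    and "\<F> \<subseteq> LpW_fun p W"
    and bounded: "(SUP f\<in>\<F>. LpW_norm p W f) < \<infinity>"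
    and vanishing: "((\<lambda>R::real. SUP f\<in>\<F>. LpW_norm p W (\<lambda>x. indicator (- ball 0 R) x *\<^sub>R f x))
           \<longlongrightarrow> 0) at_top"
    and equicontinuous: "((\<lambda>r::real. SUP f\<in>\<F>. SUP y\<in>ball 0 r.
           LpW_norm p W (\<lambda>x. translate y f x - f x)) \<longlongrightarrow> 0) (at_right 0)"
  shows "LpW_precompact p W (LpW_class p W ` \<F>)"
proof -
  have "1 < ess_lower p"
    using assms(1) by (simp add: exponents_def)
  then have "AE x in lebesgue. 1 < ereal (p x)"
    unfolding ess_lower_def by (rule less_LiminfD)
  then have "AE x in lebesgue. 1 < p x"
    by (simp add: one_ereal_def)
  then interpret weighted_exponent p W
    using assms(1,2) by unfold_locales (auto simp: exponents_def matrix_Ap_def)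
  interpret Metric_space "LpW p W" "LpW_dist p W"
    by (rule LpW_Metric_space)
  have Ap: "Ap_characteristic p W < \<infinity>"
    using assms(2) by (simp add: matrix_Ap_def)
  have "mtotally_bounded (LpW_class p W ` \<F>)"
    unfolding mtotally_bounded_def
  proof safe
    fix e :: real assume e: "0 < e"
    obtain \<Phi> :: "(real^'n \<Rightarrow> real^'m) \<Rightarrow> real^'n \<Rightarrow> real^'m" where \<Phi>: "finite (\<Phi> ` \<F>)"
      "\<And>f g. f \<in> \<F> \<Longrightarrow> g \<in> \<F> \<Longrightarrow> \<Phi> f = \<Phi> g \<Longrightarrow> LpW_norm p W (\<lambda>x. f x - g x) < ennreal e"
      using finite_pieces[OF Ap assms(3) bounded vanishing equicontinuous e] by blast
    \<comment> \<open>One function is kept for each value of \<open>\<Phi>\<close>; total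
      boundedness asks for centres inside the set.\<close>
    obtain G where G: "G \<subseteq> \<F>" "finite G" "\<Phi> ` \<F> = \<Phi> ` G"
      using finite_subset_image[OF \<Phi>(1) subset_refl] by blast
    have "LpW_class p W f \<in> (\<Union>A\<in>LpW_class p W ` G. mball A e)" if f: "f \<in> \<F>" for f
    proof -
      obtain g where g: "g \<in> G" "\<Phi> g = \<Phi> f"
        using f G(3) by (metis imageE imageI)
      have LpW: "f \<in> LpW_fun p W" "g \<in> LpW_fun p W"
        using f g(1) G(1) assms(3) by auto
      have "LpW_dist p W (LpW_class p W g) (LpW_class p W f) < e"
        using \<Phi>(2)[of g f] g f G(1) e LpW by (auto simp: LpW_dist_class_less_iff)
      then show ?thesis
        using g(1) LpW LpW_class_in by auto
    qed
    then show "\<exists>K. finite K \<and> K \<subseteq> LpW_class p W ` \<F> \<and> LpW_class p W ` \<F> \<subseteq> (\<Union>A\<in>K. mball A e)"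
      using G(1,2) by (intro exI[of _ "LpW_class p W ` G"]) auto
  qed
  \<comment> \<open>Completeness turns total boundedness into compactness of the closure.\<close>
  then show ?thesis
    using mtotally_bounded_eq_compact_closure_of[OF LpW_mcomplete]
    by (simp add: LpW_precompact_def LpW_topology_def)
qed

end
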